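(* Let $k_0, k_1, k_2, l_0, l_1, l_2$ be six generic lines in the projective plane $\mathbb{P}^2$, and consider the $2\times 2$ grid of quadrilaterals $Q_{i,j} := \Box(k_{i-1},l_{j-1},k_i,l_j)$, $i,j\in\{1,2\}$. Let $r_{i,j}$ be the intersection point of the diagonals of $Q_{i,j}$. Then the following are equivalent. (i) The six lines $k_0, k_1, k_2, l_0, l_1, l_2$ are tangent to a non-degenerate conic. (ii) The $2 \times 2$ grid of quadrilaterals admits an instance of touching inscribed conics $\mathcal{C}_{i,j}$ such that each of the following four sets is a set of collinear points: $$\{K_{0,1}l_0,\ r_{1,1},\ K_{0,1}l_{1},\ r_{1,2},\ K_{0,1}l_{2}\},\qquad \{k_{0}L_{1,2},\ r_{1,2},\ k_{1}L_{1,2},\ r_{2,2},\ k_{2}L_{1,2}\},$$ $$\{K_{1,2}l_{0},\ r_{2,1},\ K_{1,2}l_{1},\ r_{2,2},\ K_{1,2}l_{2}\},\qquad \{k_{0}L_{0,1},\ r_{1,1},\ k_{1}L_{0,1},\ r_{2,1},\ k_{2}L_{0,1}\},$$ where $K_{i-1,i}l_{j-1}$, $K_{i-1,i}l_j$, $k_{i-1}L_{j-1,j}$, $k_iL_{j-1,j}$ denote the tangency points of the conic $\mathcal{C}_{i,j}$ inscribed in $Q_{i,j}$ on the edge-lines $l_{j-1}, l_j, k_{i-1}, k_i$, respectively. (iii) The $2\times 2$ grid of quadrilaterals admits an instance of touching inscribed conics. (iv) The $2\times 2$ grid of quadrilaterals admits a $1$-parameter family of touching inscribed conics. (v) The three lines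 $(r_{1,1}, r_{2,1})$, $(r_{1,2}, r_{2,2})$ and $l_1$ are concurrent. (vi) The three lines $(r_{1,1} , r_{1,2})$, $(r_{2,1}, r_{2,2})$ and $k_1$ are concurrent.
   Context: The projective plane is real. Lines are called generic if they are pairwise distinct and no three of them are concurrent. $(a,b)$ denotes the line through points $a,b$. For lines $k,l,k',l'$ that are generic, $\Box(k,l,k',l')$ denotes the quadrilateral with consecutive vertices $k\cap l,\ k\cap l',\ k'\cap l',\ k'\cap l$; its edge-lines are $k,l',k',l$, and its diagonals are $(k\cap l, k'\cap l')$ and $(k\cap l', k'\cap l)$. Inscribed conics: a non-degenerate inscribed conic of a quadrilateral is a non-degenerate conic tangent to the four edge-lines at points (the tangency points) distinct from the vertices. In addition, exactly one degenerate conic counts as an inscribed conic: the double line supported on the line joining the two intersection points of opposite edge-lines ($k\cap k'$ and $l\cap l'$); its tangency points are its intersection points with the edge-lines. Two quadrilaterals of the grid are neighbouring if they share an edge ($Q_{i,j}$ and $Q_{i+1,j}$ share the edge on $k_i$; $Q_{i,j}$ and $Q_{i,j+1}$ share the edge on $l_j$). An instance of touching inscribed conics is a choice of an inscribed conic $\mathcal{C}_{i,j}$ in each $Q_{i,j}$ such that for any two neighbouring quadrilaterals the two inscribed conics have the same tangency point on their common edge-line; consequently the labels $K_{i-1,i}l_j$ (tangency point on $l_j$ of the conics in the strip $\{Q_{i,1},Q_{i,2}\}$) and $k_iL_{j-1,j}$ (tangency point on $k_i$ of the conics in the strip $\{Q_{1,j},Q_{2,j}\}$) are well defined. The grid admits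 a $1$-parameter family of touching inscribed conics if, for every edge of the grid and every point $p$ on the corresponding edge-line different from the two endpoints of the edge, there is exactly one instance of touching inscribed conics with tangency point $p$ on that edge. *)

theory Defs
  imports "HOL-Analysis.Analysis"
begin

text \<open>Points and lines of the real projective plane are given by homogeneous coordinates.\<close>

definition proportional :: "real ^ 3 \<Rightarrow> real ^ 3 \<Rightarrow> bool" where
  "proportional u v \<longleftrightarrow> u \<noteq> 0 \<and> v \<noteq> 0 \<and> (\<exists>c. c \<noteq> 0 \<and> u = c *\<^sub>R v)"

lemma part_equivp_proportional: "part_equivp proportional"
proof (rule part_equivpI)
  have "proportional (axis 1 1) (axis 1 1)"
    by (simp add: proportional_def axis_eq_0_iff) (rule exI[of _ 1], simp)
  then show "\<exists>u. proportional u u" by blast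
  show "symp proportional"
  proof (rule sympI)
    fix u v
    assume R: "proportional u v"
    then obtain c where "c \<noteq> 0" "u = c *\<^sub>R v" unfolding proportional_def by blast
    then have "inverse c \<noteq> 0 \<and> v = inverse c *\<^sub>R u" by simp
    with R show "proportional v u" unfolding proportional_def by blast
  qed
  show "transp proportional"
  proof (rule transpI, unfold proportional_def, elim conjE exE)
    fix u v w :: "real ^ 3" and c d :: real
    assume "u \<noteq> 0" "w \<noteq> 0" "c \<noteq> 0" "u = c *\<^sub>R v" "d \<noteq> 0" "v = d *\<^sub>R w"
    then show "u \<noteq> 0 \<and> w \<noteq> 0 \<and> (\<exists>c. c \<noteq> 0 \<and> u = c *\<^sub>R w)"
      by (intro conjI exI[of _ "c * d"]) auto
  qed
qed

quotient_type ppoint = "real ^ 3" / partial: proportional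
  by (rule part_equivp_proportional)

text \<open>The vector \<open>a\<close> represents the line \<open>{p. p \<bullet> a = 0}\<close>.\<close>

quotient_type pline = "real ^ 3" / partial: proportional
  by (rule part_equivp_proportional)

lift_definition lies_on :: "ppoint \<Rightarrow> pline \<Rightarrow> bool" is "\<lambda>p a. p \<bullet> a = 0"
  by (auto simp: proportional_def)

definition join :: "ppoint \<Rightarrow> ppoint \<Rightarrow> pline" where
  "join p q = (THE a. lies_on p a \<and> lies_on q a)"

definition meet :: "pline \<Rightarrow> pline \<Rightarrow> ppoint" where
  "meet a b = (THE p. lies_on p a \<and> lies_on p b)"

definition pcollinear :: "ppoint set \<Rightarrow> bool" where
  "pcollinear S \<longleftrightarrow> (\<exists>a. \<forall>p\<in>S. lies_on p a)"

definition concurrent :: "pline set \<Rightarrow> bool" where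
  "concurrent S \<longleftrightarrow> (\<exists>p. \<forall>a\<in>S. lies_on p a)"

definition generic :: "pline list \<Rightarrow> bool" where
  "generic as \<longleftrightarrow> distinct as \<and>
     (\<forall>a b c. {a, b, c} \<subseteq> set as \<and> distinct [a, b, c] \<longrightarrow> \<not> concurrent {a, b, c})"

text \<open>A conic is a nonzero quadratic form up to scaling, given by its symmetric matrix.\<close>

quotient_type conic = "real ^ 3 ^ 3" /
  partial: "\<lambda>A B. A \<noteq> 0 \<and> B \<noteq> 0 \<and> transpose A = A \<and> transpose B = B \<and>
                   (\<exists>c. c \<noteq> 0 \<and> A = c *\<^sub>R B)"
proof (rule part_equivpI)
  let ?R = "\<lambda>A B :: real ^ 3 ^ 3. A \<noteq> 0 \<and> B \<noteq> 0 \<and> transpose A = A \<and> transpose B = B \<and>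
                   (\<exists>c. c \<noteq> 0 \<and> A = c *\<^sub>R B)"
  have "(mat 1 :: real ^ 3 ^ 3) $ 1 $ 1 \<noteq> 0 $ 1 $ 1" by (simp add: mat_def)
  then have "(mat 1 :: real ^ 3 ^ 3) \<noteq> 0" by metis
  then have "?R (mat 1) (mat 1)"
    by (simp add: transpose_mat) (rule exI[of _ 1], simp)
  then show "\<exists>A. ?R A A" by blast
  show "symp ?R"
  proof (rule sympI)
    fix A B :: "real ^ 3 ^ 3"
    assume R: "?R A B"
    then obtain c where c: "c \<noteq> 0" "A = c *\<^sub>R B" by blast
    then have "inverse c \<noteq> 0 \<and> B = inverse c *\<^sub>R A" by simp
    with R show "?R B A" by blast
  qed
  show "transp ?R"
  proof (rule transpI, elim conjE exE)
    fix A B D :: "real ^ 3 ^ 3" and c d :: real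
    assume "A \<noteq> 0" "D \<noteq> 0" "transpose A = A" "transpose D = D"
      "c \<noteq> 0" "A = c *\<^sub>R B" "d \<noteq> 0" "B = d *\<^sub>R D"
    then show "?R A D"
      by (intro conjI exI[of _ "c * d"]) auto
  qed
qed

lift_definition nondegenerate :: "conic \<Rightarrow> bool" is "\<lambda>A. det A \<noteq> 0"
proof -
  fix A B :: "real ^ 3 ^ 3"
  assume "A \<noteq> 0 \<and> B \<noteq> 0 \<and> transpose A = A \<and> transpose B = B \<and>
            (\<exists>c. c \<noteq> 0 \<and> A = c *\<^sub>R B)"
  then obtain c where "c \<noteq> 0" "A = c *\<^sub>R B" by blast
  then have "det A = c ^ 3 * det B"
    by (simp add: det_3 power3_eq_cube algebra_simps)
  with \<open>c \<noteq> 0\<close> show "(det A \<noteq> 0) = (det B \<noteq> 0)"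
    by simp
qed

lift_definition conjugate :: "conic \<Rightarrow> ppoint \<Rightarrow> ppoint \<Rightarrow> bool" is
  "\<lambda>A p q. p \<bullet> (A *v q) = 0"
proof -
  fix A B :: "real ^ 3 ^ 3" and p p' q q' :: "real ^ 3"
  assume "A \<noteq> 0 \<and> B \<noteq> 0 \<and> transpose A = A \<and> transpose B = B \<and>
            (\<exists>c. c \<noteq> 0 \<and> A = c *\<^sub>R B)"
    and "proportional p p'" and "proportional q q'"
  then obtain a b c where "a \<noteq> 0" "A = a *\<^sub>R B" "b \<noteq> 0" "p = b *\<^sub>R p'" "c \<noteq> 0" "q = c *\<^sub>R q'"
    unfolding proportional_def by blast
  then show "(p \<bullet> (A *v q) = 0) = (p' \<bullet> (B *v q') = 0)"
    by (simp add: matrix_vector_mult_scaleR scaleR_matrix_vector_assoc[symmetric])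
qed

definition on_conic :: "ppoint \<Rightarrow> conic \<Rightarrow> bool" where
  "on_conic p C \<longleftrightarrow> conjugate C p p"

text \<open>
  The quadratic form of \<open>C\<close> restricted to the line \<open>a\<close> vanishes to second order at \<open>p\<close>.
  For non-degenerate \<open>C\<close> this says that \<open>a\<close> is the tangent line (the polar) of the point
  \<open>p\<close> of \<open>C\<close>; for a double line it just says that \<open>p\<close> lies on both lines, see
  \<open>tangent_at_double_line\<close> below.
\<close>

definition tangent_at :: "conic \<Rightarrow> pline \<Rightarrow> ppoint \<Rightarrow> bool" where
  "tangent_at C a p \<longleftrightarrow> lies_on p a \<and> on_conic p C \<and> (\<forall>q. lies_on q a \<longrightarrow> conjugate C p q)"

definition tangency_point :: "conic \<Rightarrow> pline \<Rightarrow> ppoint" where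
  "tangency_point C a = (THE p. tangent_at C a p)"

lift_definition double_line :: "pline \<Rightarrow> conic" is "\<lambda>a. \<chi> i j. a $ i * a $ j"
proof -
  fix u v :: "real ^ 3"
  let ?d = "\<lambda>a :: real ^ 3. \<chi> i j. a $ i * a $ j"
  assume "proportional u v"
  then obtain c where c: "u \<noteq> 0" "v \<noteq> 0" "c \<noteq> 0" "u = c *\<^sub>R v"
    unfolding proportional_def by blast
  have nz: "?d a \<noteq> 0" if "a \<noteq> 0" for a
  proof
    assume "?d a = 0"
    then have "a $ i * a $ i = 0" for i by (simp add: vec_eq_iff)
    with that show False by (simp add: vec_eq_iff)
  qed
  have "c * c \<noteq> 0 \<and> ?d u = (c * c) *\<^sub>R ?d v"
    using c by (simp add: vec_eq_iff)
  then have "\<exists>c. c \<noteq> 0 \<and> ?d u = c *\<^sub>R ?d v" by blast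
  moreover have "transpose (?d a) = ?d a" for a
    by (simp add: transpose_def vec_eq_iff)
  ultimately show "?d u \<noteq> 0 \<and> ?d v \<noteq> 0 \<and> transpose (?d u) = ?d u \<and> transpose (?d v) = ?d v \<and>
          (\<exists>c. c \<noteq> 0 \<and> ?d u = c *\<^sub>R ?d v)"
    using nz c(1,2) by blast
qed

lemma conjugate_double_line:
  "conjugate (double_line a) p q \<longleftrightarrow> lies_on p a \<or> lies_on q a"
proof transfer
  fix a p q :: "real ^ 3"
  have "p \<bullet> ((\<chi> i j. a $ i * a $ j) *v q) = (p \<bullet> a) * (q \<bullet> a)"
    by (simp add: inner_vec_def matrix_vector_mult_def sum_3 algebra_simps)
  then show "(p \<bullet> ((\<chi> i j. a $ i * a $ j) *v q) = 0) = (p \<bullet> a = 0 \<or> q \<bullet> a = 0)"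
    by simp
qed

lemma tangent_at_double_line:
  "tangent_at (double_line a) b p \<longleftrightarrow> lies_on p a \<and> lies_on p b"
  by (auto simp: tangent_at_def on_conic_def conjugate_double_line)

text \<open>
  The quadrilateral with edge-lines \<open>k, l', k', l\<close> has consecutive vertices
  \<open>k \<inter> l\<close>, \<open>k \<inter> l'\<close>, \<open>k' \<inter> l'\<close>, \<open>k' \<inter> l\<close>.
\<close>

definition vertices :: "pline \<Rightarrow> pline \<Rightarrow> pline \<Rightarrow> pline \<Rightarrow> ppoint set" where
  "vertices k l k' l' = {meet k l, meet k l', meet k' l', meet k' l}"

definition diagonal_point :: "pline \<Rightarrow> pline \<Rightarrow> pline \<Rightarrow> pline \<Rightarrow> ppoint" where
  "diagonal_point k l k' l' =
     meet (join (meet k l) (meet k' l')) (join (meet k l') (meet k' l))"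

text \<open>
  The second disjunct is the one degenerate conic admitted as inscribed; its tangency points
  are where that line meets the edge-lines.
\<close>

definition inscribed :: "pline \<Rightarrow> pline \<Rightarrow> pline \<Rightarrow> pline \<Rightarrow> conic \<Rightarrow> bool" where
  "inscribed k l k' l' C \<longleftrightarrow>
     nondegenerate C \<and> (\<forall>a \<in> {k, l', k', l}. \<exists>p. tangent_at C a p \<and> p \<notin> vertices k l k' l')
     \<or> C = double_line (join (meet k k') (meet l l'))"

definition grid_diagonal_point :: "(nat \<Rightarrow> pline) \<Rightarrow> (nat \<Rightarrow> pline) \<Rightarrow> nat \<Rightarrow> nat \<Rightarrow> ppoint" where
  "grid_diagonal_point k l i j = diagonal_point (k (i - 1)) (l (j - 1)) (k i) (l j)"

text \<open>
  The conic in \<open>Q\<^sub>i\<^sub>j\<close> is \<open>C (i, j)\<close>. Extensionality fixes the irrelevant values of \<open>C\<close>, so that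
  uniqueness of instances is meaningful.
\<close>

definition touching_instance ::
    "(nat \<Rightarrow> pline) \<Rightarrow> (nat \<Rightarrow> pline) \<Rightarrow> (nat \<times> nat \<Rightarrow> conic) \<Rightarrow> bool" where
  "touching_instance k l C \<longleftrightarrow>
     C \<in> extensional ({1, 2} \<times> {1, 2}) \<and>
     (\<forall>i \<in> {1, 2}. \<forall>j \<in> {1, 2}. inscribed (k (i - 1)) (l (j - 1)) (k i) (l j) (C (i, j))) \<and>
     (\<forall>j \<in> {1, 2}. tangency_point (C (1, j)) (k 1) = tangency_point (C (2, j)) (k 1)) \<and>
     (\<forall>i \<in> {1, 2}. tangency_point (C (i, 1)) (l 1) = tangency_point (C (i, 2)) (l 1))"

text \<open>
  The edges of the grid are enumerated as the edges of the individual quadrilaterals. An edge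
  shared by two of them occurs twice, with equivalent conditions since the conics touch there.
\<close>

definition touching_family :: "(nat \<Rightarrow> pline) \<Rightarrow> (nat \<Rightarrow> pline) \<Rightarrow> bool" where
  "touching_family k l \<longleftrightarrow>
     (\<forall>i \<in> {1, 2}. \<forall>j \<in> {1, 2}.
        (\<forall>m \<in> {i - 1, i}. \<forall>p. lies_on p (k m) \<and> p \<noteq> meet (k m) (l (j - 1)) \<and> p \<noteq> meet (k m) (l j) \<longrightarrow>
           (\<exists>!C. touching_instance k l C \<and> tangency_point (C (i, j)) (k m) = p)) \<and>
        (\<forall>m \<in> {j - 1, j}. \<forall>p. lies_on p (l m) \<and> p \<noteq> meet (k (i - 1)) (l m) \<and> p \<noteq> meet (k i) (l m) \<longrightarrow>
           (\<exists>!C. touching_instance k l C \<and> tangency_point (C (i, j)) (l m) = p)))"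

definition all_equivalent :: "bool list \<Rightarrow> bool" where
  "all_equivalent Ps \<longleftrightarrow> (\<forall>P \<in> set Ps. \<forall>Q \<in> set Ps. P \<longleftrightarrow> Q)"

end

theory Submission
  imports Defs
begin

text \<open>
  All six conditions are reduced to one polynomial identity between the six lines. Write
  \<open>[a b c]\<close> for the determinant of three representing vectors.

  \<^emph>\<open>Inscribed conics form a punctured line.\<close> A conic tangent to given lines is best described by
  its dual form \<open>E\<close>: the lines \<open>a\<close> with \<open>a \<bullet> E a = 0\<close> are its tangents, and the tangent \<open>a\<close>
  touches at the point \<open>E a\<close>. The forms vanishing on the four edge-lines of a quadrilateral form
  a pencil, spanned by the two pairs of opposite vertices. Removing these two members
  leaves one parameter \<open>t \<noteq> 0\<close>, and the value \<open>t = -1\<close> is the pair of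
  intersection points of opposite edge-lines, whose cofactor matrix is exactly the admitted
  double line (\<open>inscribed_iff_inconic\<close>). So the degenerate conic needs no separate treatment
  afterwards, and the tangency point on an edge-line is a bijective function of \<open>t\<close>
  (\<open>edge_point_parameter\<close>).

  \<^emph>\<open>Touching is multiplicative.\<close> Inscribed conics of neighbouring quadrilaterals with parameters
  \<open>t\<close> and \<open>t'\<close> touch iff \<open>t * t'\<close> has a value determined by the lines (\<open>touching_iff\<close>).
  Hence an instance is a \<open>2 \<times> 2\<close> array of nonzero numbers with prescribed row and column products.
  Such an array exists iff the product of the row products is the product of the column products,
  and then any one entry may be chosen freely and determines the others. This gives (iii) and (iv),
  and the compatibility condition is the identity \<open>six_tangent\<close> (\<open>column_products_eq_iff\<close>).

  \<^emph>\<open>Six tangents.\<close> In the pencil of the outer quadrilateral, with edge-lines \<open>k\<^sub>0, l\<^sub>0, k\<^sub>2, l\<^sub>2\<close>,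
  tangency to \<open>k\<^sub>1\<close> and tangency to \<open>l\<^sub>1\<close> are two linear equations for the parameter; they have
  a common solution iff the same identity holds (\<open>ex_enveloped_iff_six_tangent\<close>). This is (i).

  \<^emph>\<open>Concurrency.\<close> Each diagonal point is an explicit combination of two opposite vertices. The two
  lines in (v) each join two diagonal points whose quadrilaterals share a vertex off \<open>l\<^sub>1\<close>, so they
  meet \<open>l\<^sub>1\<close> in explicit combinations of \<open>k\<^sub>0 \<inter> l\<^sub>1\<close> and \<open>k\<^sub>2 \<inter> l\<^sub>1\<close>, which agree iff the identity
  holds (\<open>concurrent_diagonal_vectors_iff\<close>). Exchanging the two families of lines gives (vi).

  \<^emph>\<open>Collinearity.\<close> The conic tangent to all six lines is inscribed in each quadrilateral, with
  parameters \<open>t\<close>. The touching equations only involve products of two parameters, so \<open>- t\<close> solves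
  them as well. On each edge-line the new tangency point is the harmonic conjugate of the old one
  with respect to the endpoints of the edge, and therefore lies on a chord of contact of the big
  conic; so do the diagonal points (\<open>chord_collinear\<close>). This is the instance for (ii).
\<close>

unbundle cross3_syntax

section \<open>Homogeneous coordinates\<close>

lemma proportional_refl_iff: "proportional v v \<longleftrightarrow> v \<noteq> 0"
  by (auto simp: proportional_def intro: exI[of _ 1])

lemma ppoint_rep:
  obtains v where "v \<noteq> 0" "p = abs_ppoint v"
  by (metis Quotient3_ppoint Quotient3_def proportional_refl_iff)

lemma pline_rep:
  obtains v where "v \<noteq> 0" "a = abs_pline v"
  by (metis Quotient3_pline Quotient3_def proportional_refl_iff)

lemma conic_rep:
  obtains A where "A \<noteq> 0" "transpose A = A" "C = abs_conic A"
  by (induct C rule: conic.abs_induct) blast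

lemma cross_eq_0_imp_multiple:
  fixes u v :: "real ^ 3"
  assumes "u \<times> v = 0" "v \<noteq> 0"
  obtains c where "u = c *\<^sub>R v"
proof -
  have "v \<times> (u \<times> v) = (v \<bullet> v) *\<^sub>R u - (v \<bullet> u) *\<^sub>R v"
    by (rule Lagrange)
  with assms have "(v \<bullet> v) *\<^sub>R u = (v \<bullet> u) *\<^sub>R v" by simp
  moreover have "u = inverse (v \<bullet> v) *\<^sub>R ((v \<bullet> v) *\<^sub>R u)"
    using assms(2) by simp
  ultimately have "u = (inverse (v \<bullet> v) * (v \<bullet> u)) *\<^sub>R v" by simp
  then show thesis by (rule that)
qed

lemma proportional_iff_cross:
  assumes "u \<noteq> 0" "v \<noteq> 0"
  shows "proportional u v \<longleftrightarrow> u \<times> v = 0"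
  using assms unfolding proportional_def
  by (metis cross_eq_0_imp_multiple cross_mult_left cross_refl scaleR_zero_left scaleR_zero_right)

text \<open>
  The cross product detects equality of points without producing a scaling factor, which turns
  incidence questions into identities.
\<close>

lemma abs_ppoint_eq_iff:
  assumes "u \<noteq> 0" "v \<noteq> 0"
  shows "abs_ppoint u = abs_ppoint v \<longleftrightarrow> u \<times> v = 0"
  using assms proportional_iff_cross[OF assms] Quotient3_rel[OF Quotient3_ppoint, of u v]
  by (simp add: proportional_refl_iff)

lemma abs_pline_eq_iff:
  assumes "u \<noteq> 0" "v \<noteq> 0"
  shows "abs_pline u = abs_pline v \<longleftrightarrow> u \<times> v = 0"
  using assms proportional_iff_cross[OF assms] Quotient3_rel[OF Quotient3_pline, of u v]
  by (simp add: proportional_refl_iff)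

lemma abs_ppoint_scaleR:
  "c \<noteq> 0 \<Longrightarrow> u \<noteq> 0 \<Longrightarrow> abs_ppoint (c *\<^sub>R u) = abs_ppoint u"
  by (simp add: abs_ppoint_eq_iff cross_mult_left)

lemma abs_pline_scaleR:
  "c \<noteq> 0 \<Longrightarrow> u \<noteq> 0 \<Longrightarrow> abs_pline (c *\<^sub>R u) = abs_pline u"
  by (simp add: abs_pline_eq_iff cross_mult_left)

lemma abs_conic_scaleR:
  assumes "c \<noteq> 0" "A \<noteq> 0" "transpose A = A"
  shows "abs_conic (c *\<^sub>R A) = abs_conic A"
proof (rule Quotient3_rel_abs[OF Quotient3_conic])
  have "transpose (c *\<^sub>R A) = c *\<^sub>R A"
    using assms by (simp add: vec_eq_iff transpose_def)
  with assms show "c *\<^sub>R A \<noteq> 0 \<and> A \<noteq> 0 \<and> transpose (c *\<^sub>R A) = c *\<^sub>R A \<and> transpose A = A \<and>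
      (\<exists>d. d \<noteq> 0 \<and> c *\<^sub>R A = d *\<^sub>R A)"
    by auto
qed

lemma lies_on_abs:
  "p \<noteq> 0 \<Longrightarrow> a \<noteq> 0 \<Longrightarrow> lies_on (abs_ppoint p) (abs_pline a) \<longleftrightarrow> p \<bullet> a = 0"
  by (simp add: lies_on.abs_eq proportional_refl_iff)

lemma conjugate_abs:
  "A \<noteq> 0 \<Longrightarrow> transpose A = A \<Longrightarrow> p \<noteq> 0 \<Longrightarrow> q \<noteq> 0 \<Longrightarrow>
    conjugate (abs_conic A) (abs_ppoint p) (abs_ppoint q) \<longleftrightarrow> p \<bullet> (A *v q) = 0"
  by (rule conjugate.abs_eq) (auto simp: proportional_refl_iff intro: exI[of _ 1])

lemma nondegenerate_abs:
  "A \<noteq> 0 \<Longrightarrow> transpose A = A \<Longrightarrow> nondegenerate (abs_conic A) \<longleftrightarrow> det A \<noteq> 0"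
  by (rule nondegenerate.abs_eq) (auto intro: exI[of _ 1])

lemma double_line_abs:
  "a \<noteq> 0 \<Longrightarrow> double_line (abs_pline a) = abs_conic (\<chi> i j. a $ i * a $ j)"
  by (rule double_line.abs_eq) (simp add: proportional_refl_iff)

lemma orthogonal_both_imp_multiple_cross:
  fixes a b p :: "real ^ 3"
  assumes "p \<bullet> a = 0" "p \<bullet> b = 0" "a \<times> b \<noteq> 0"
  obtains c where "p = c *\<^sub>R (a \<times> b)"
proof (rule cross_eq_0_imp_multiple)
  have "p \<times> (a \<times> b) = (p \<bullet> b) *\<^sub>R a - (p \<bullet> a) *\<^sub>R b" by (rule Lagrange)
  with assms show "p \<times> (a \<times> b) = 0" by simp
qed (use assms in auto)

text \<open>
  Definite descriptions such as meet are pinned down only for distinct arguments; here the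
  common points form a single class because the orthogonal complement of two independent
  vectors is spanned by their cross product.
\<close>

lemma meet_abs:
  assumes ab: "a \<times> b \<noteq> 0"
  shows "meet (abs_pline a) (abs_pline b) = abs_ppoint (a \<times> b)"
proof -
  have nz: "a \<noteq> 0" "b \<noteq> 0" using ab by auto
  show ?thesis unfolding meet_def
  proof (rule the_equality)
    show "lies_on (abs_ppoint (a \<times> b)) (abs_pline a) \<and> lies_on (abs_ppoint (a \<times> b)) (abs_pline b)"
      using ab nz by (simp add: lies_on_abs dot_cross_self)
  next
    fix p assume p: "lies_on p (abs_pline a) \<and> lies_on p (abs_pline b)"
    obtain v where v: "v \<noteq> 0" "p = abs_ppoint v" by (rule ppoint_rep)
    with p nz have "v \<bullet> a = 0" "v \<bullet> b = 0" by (simp_all add: lies_on_abs)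
    then obtain c where "v = c *\<^sub>R (a \<times> b)" using ab orthogonal_both_imp_multiple_cross by blast
    with v ab show "p = abs_ppoint (a \<times> b)" by (cases "c = 0") (auto simp: abs_ppoint_scaleR)
  qed
qed

lemma join_abs:
  assumes ab: "p \<times> q \<noteq> 0"
  shows "join (abs_ppoint p) (abs_ppoint q) = abs_pline (p \<times> q)"
proof -
  have nz: "p \<noteq> 0" "q \<noteq> 0" using ab by auto
  show ?thesis unfolding join_def
  proof (rule the_equality)
    show "lies_on (abs_ppoint p) (abs_pline (p \<times> q)) \<and> lies_on (abs_ppoint q) (abs_pline (p \<times> q))"
      using ab nz by (simp add: lies_on_abs dot_cross_self)
  next
    fix a assume p: "lies_on (abs_ppoint p) a \<and> lies_on (abs_ppoint q) a"
    obtain v where v: "v \<noteq> 0" "a = abs_pline v" by (rule pline_rep)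
    with p nz have "v \<bullet> p = 0" "v \<bullet> q = 0" by (simp_all add: lies_on_abs inner_commute)
    then obtain c where "v = c *\<^sub>R (p \<times> q)" using ab orthogonal_both_imp_multiple_cross by blast
    with v ab show "a = abs_pline (p \<times> q)" by (cases "c = 0") (auto simp: abs_pline_scaleR)
  qed
qed

lemma meet_commute: "meet a b = meet b a"
  by (simp add: meet_def conj_commute)

lemma join_commute: "join p q = join q p"
  by (simp add: join_def conj_commute)

section \<open>Brackets\<close>

definition bracket :: "real ^ 3 \<Rightarrow> real ^ 3 \<Rightarrow> real ^ 3 \<Rightarrow> real" where
  "bracket a b c = (a \<times> b) \<bullet> c"

lemma bracket_rotate: "bracket a b c = bracket b c a"
  unfolding bracket_def by (rule cross_triple)

lemma bracket_swap: "bracket a b c = - bracket b a c"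
  unfolding bracket_def by (subst cross_skew) simp

lemma bracket_same [simp]: "bracket a a b = 0" "bracket a b a = 0" "bracket b a a = 0"
  by (simp_all add: bracket_def dot_cross_self inner_commute)

lemma bracket_linear:
  "bracket (a + b) c d = bracket a c d + bracket b c d"
  "bracket a (b + c) d = bracket a b d + bracket a c d"
  "bracket a b (c + d) = bracket a b c + bracket a b d"
  "bracket (x *\<^sub>R a) b c = x * bracket a b c"
  "bracket a (x *\<^sub>R b) c = x * bracket a b c"
  "bracket a b (x *\<^sub>R c) = x * bracket a b c"
  "bracket (- a) b c = - bracket a b c"
  "bracket a (- b) c = - bracket a b c"
  "bracket a b (- c) = - bracket a b c"
  "bracket (a - b) c d = bracket a c d - bracket b c d"
  "bracket a (b - c) d = bracket a b d - bracket a c d"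
  "bracket a b (c - d) = bracket a b c - bracket a b d"
  by (simp_all add: bracket_def cross_add_left cross_add_right inner_add_left inner_add_right
      cross_mult_left cross_mult_right Cross3.left_diff_distrib Cross3.right_diff_distrib inner_diff_left inner_diff_right)

lemma bracket_neq_0_imp:
  assumes "bracket a b c \<noteq> 0"
  shows "a \<noteq> 0" "b \<noteq> 0" "c \<noteq> 0" "a \<times> b \<noteq> 0" "a \<times> c \<noteq> 0" "b \<times> c \<noteq> 0"
    "b \<times> a \<noteq> 0" "c \<times> a \<noteq> 0" "c \<times> b \<noteq> 0"
proof -
  have "bracket a b c = (b \<times> c) \<bullet> a" "bracket a b c = (c \<times> a) \<bullet> b"
    by (metis bracket_def bracket_rotate)+
  with assms show "a \<noteq> 0" "b \<noteq> 0" "c \<noteq> 0" "a \<times> b \<noteq> 0" "a \<times> c \<noteq> 0" "b \<times> c \<noteq> 0"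
    "b \<times> a \<noteq> 0" "c \<times> a \<noteq> 0" "c \<times> b \<noteq> 0"
    unfolding bracket_def by (auto simp: cross_skew[of a c] cross_skew[of b a] cross_skew[of c b])
qed

text \<open>
  Cramer's rule: it expresses a vector in a basis without dividing.
\<close>

lemma bracket_cramer:
  "bracket a b c *\<^sub>R x = bracket x b c *\<^sub>R a + bracket a x c *\<^sub>R b + bracket a b x *\<^sub>R c"
  by (simp add: bracket_def vec_eq_iff forall_3 cross3_def inner_vec_def sum_3 algebra_simps)

lemma concurrent_iff_bracket:
  assumes "a \<noteq> 0" "b \<noteq> 0" "c \<noteq> 0"
  shows "concurrent {abs_pline a, abs_pline b, abs_pline c} \<longleftrightarrow> bracket a b c = 0"
proof
  assume "concurrent {abs_pline a, abs_pline b, abs_pline c}"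
  then obtain p where p: "\<forall>x\<in>{abs_pline a, abs_pline b, abs_pline c}. lies_on p x"
    unfolding concurrent_def by blast
  obtain v where v: "v \<noteq> 0" "p = abs_ppoint v" by (rule ppoint_rep)
  have o: "v \<bullet> a = 0" "v \<bullet> b = 0" "v \<bullet> c = 0" using p v assms by (simp_all add: lies_on_abs)
  show "bracket a b c = 0"
  proof (rule ccontr)
    assume "bracket a b c \<noteq> 0"
    moreover then obtain d where "v = d *\<^sub>R (a \<times> b)"
      using o orthogonal_both_imp_multiple_cross bracket_neq_0_imp(4) by metis
    ultimately show False using o v by (auto simp: bracket_def)
  qed
next
  assume z: "bracket a b c = 0"
  have "\<exists>v. v \<noteq> 0 \<and> v \<bullet> a = 0 \<and> v \<bullet> b = 0 \<and> v \<bullet> c = 0"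
  proof (cases "a \<times> b = 0")
    case False
    then show ?thesis using z by (intro exI[of _ "a \<times> b"]) (simp add: bracket_def dot_cross_self inner_commute)
  next
    case True
    then obtain x where x: "a = x *\<^sub>R b" using assms cross_eq_0_imp_multiple by blast
    show ?thesis
    proof (cases "b \<times> c = 0")
      case False
      then show ?thesis using x by (intro exI[of _ "b \<times> c"]) (simp add: dot_cross_self inner_commute)
    next
      case True
      then obtain y where y: "b = y *\<^sub>R c" using assms cross_eq_0_imp_multiple by blast
      obtain w where "c \<times> w \<noteq> 0" using cross_basis_nonzero assms by blast
      then show ?thesis using x y by (intro exI[of _ "c \<times> w"]) (simp add: dot_cross_self inner_commute)
    qed
  qed
  then obtain v where "v \<noteq> 0" "v \<bullet> a = 0" "v \<bullet> b = 0" "v \<bullet> c = 0" by blast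
  then show "concurrent {abs_pline a, abs_pline b, abs_pline c}"
    unfolding concurrent_def using assms by (intro exI[of _ "abs_ppoint v"]) (simp add: lies_on_abs)
qed

section \<open>Conics as envelopes of lines\<close>

lemma bracket_mult_bracket:
  "bracket u v w * bracket a b c =
     (u \<bullet> a) * ((v \<bullet> b) * (w \<bullet> c) - (v \<bullet> c) * (w \<bullet> b))
   - (u \<bullet> b) * ((v \<bullet> a) * (w \<bullet> c) - (v \<bullet> c) * (w \<bullet> a))
   + (u \<bullet> c) * ((v \<bullet> a) * (w \<bullet> b) - (v \<bullet> b) * (w \<bullet> a))"
  by (simp add: bracket_def cross3_def inner_vec_def sum_3 algebra_simps)

lemma bracket_matrix: "bracket (M *v a) (M *v b) (M *v c) = det M * bracket a b c"
  by (simp add: bracket_def cross3_def inner_vec_def matrix_vector_mult_def sum_3 det_3 algebra_simps)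

lemma symmetric_inner_commute:
  fixes E :: "real ^ 3 ^ 3"
  assumes "transpose E = E"
  shows "x \<bullet> (E *v y) = y \<bullet> (E *v x)"
  by (metis assms dot_lmul_matrix inner_commute transpose_matrix_vector)

lemma det_neq_0_imp_kernel:
  fixes E :: "real ^ 3 ^ 3"
  assumes "det E \<noteq> 0" "E *v w = 0"
  shows "w = 0"
  using assms by (metis invertible_det_nz invertible_def matrix_left_invertible_ker)

text \<open>
  The cofactor matrix. It is used to pass between a dual form and the conic enveloped by its
  isotropic lines, also for dual forms of rank two, where the inverse does not exist.
\<close>

definition cof :: "real ^ 3 ^ 3 \<Rightarrow> real ^ 3 ^ 3" where
  "cof M = vector [M $ 2 \<times> M $ 3, M $ 3 \<times> M $ 1, M $ 1 \<times> M $ 2]"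

lemma cof_mult_cross: "cof M *v (x \<times> y) = (M *v x) \<times> (M *v y)"
  by (simp add: cof_def vec_eq_iff forall_3 cross3_def matrix_vector_mult_def sum_3 algebra_simps)

lemma transpose_cof: "transpose (cof M) = cof (transpose M)"
  by (simp add: cof_def vec_eq_iff forall_3 cross3_def transpose_def algebra_simps)

lemma cof_cof: "cof (cof M) = det M *\<^sub>R M"
  by (simp add: cof_def vec_eq_iff forall_3 cross3_def det_3 algebra_simps)

lemma cof_scaleR: "cof (c *\<^sub>R M) = (c * c) *\<^sub>R cof M"
  by (simp add: cof_def vec_eq_iff forall_3 cross3_def algebra_simps)

lemma det_cof: "det (cof M) = (det M)\<^sup>2"
  by (simp add: cof_def cross3_def det_3 power2_eq_square algebra_simps)

definition conic_of_dual :: "real ^ 3 ^ 3 \<Rightarrow> conic" where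
  "conic_of_dual E = abs_conic (cof E)"

text \<open>
  The points of the line \<open>a\<close> are the vectors \<open>a \<times> x\<close>. If \<open>a\<close> is isotropic for a symmetric \<open>E\<close>, the first
  product vanishes, so the restriction of the conic to \<open>a\<close> is, up to sign, the square of the
  linear form \<open>x \<mapsto> x \<bullet> E a\<close>: the line is tangent.
\<close>

lemma cof_form:
  "(a \<times> x) \<bullet> (cof E *v (a \<times> y)) = (a \<bullet> (E *v a)) * (x \<bullet> (E *v y)) - (a \<bullet> (E *v y)) * (x \<bullet> (E *v a))"
  by (simp add: cof_mult_cross dot_cross)

lemma orthogonal_imp_cross:
  fixes a v :: "real ^ 3"
  assumes "v \<bullet> a = 0" "a \<noteq> 0"
  obtains x where "v = a \<times> x"
proof -
  have "a \<times> (v \<times> a) = (a \<bullet> a) *\<^sub>R v" using assms by (simp add: Lagrange inner_commute)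
  then have "v = inverse (a \<bullet> a) *\<^sub>R (a \<times> (v \<times> a))" using assms by simp
  then show thesis using that cross_mult_right by metis
qed

lemma cof_neq_0:
  assumes sym: "transpose E = E" and iso: "a \<bullet> (E *v a) = 0" and nz: "E *v a \<noteq> 0"
  shows "cof E \<noteq> 0"
proof
  assume "cof E = 0"
  then have "(a \<times> (E *v a)) \<bullet> (cof E *v (a \<times> (E *v a))) = 0"
    by simp
  then have "((E *v a) \<bullet> (E *v a)) * ((E *v a) \<bullet> (E *v a)) = 0"
    using iso symmetric_inner_commute[OF sym, of a "E *v a"] by (simp only: cof_form)
  with nz show False by simp
qed

text \<open>
  By \<open>cof_form\<close> the conic restricted to \<open>a\<close> has a double zero where \<open>x \<bullet> E a = 0\<close>, and there
  \<open>a \<times> x\<close> is proportional to \<open>E a\<close>. The argument also applies to singular \<open>E\<close>,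
  that is, to double lines.
\<close>

lemma tangent_at_conic_of_dual_iff:
  assumes sym: "transpose E = E" and iso: "a \<bullet> (E *v a) = 0" and nz: "E *v a \<noteq> 0"
  shows "tangent_at (conic_of_dual E) (abs_pline a) p \<longleftrightarrow> p = abs_ppoint (E *v a)"
proof -
  define e where "e = E *v a"
  have a0: "a \<noteq> 0" using nz by auto
  have ae: "a \<bullet> e = 0" "e \<noteq> 0" using iso nz by (simp_all add: e_def)
  have form: "(a \<times> x) \<bullet> (cof E *v (a \<times> y)) = - ((e \<bullet> x) * (e \<bullet> y))" for x y
    using iso symmetric_inner_commute[OF sym, of a y] by (simp add: cof_form e_def inner_commute)
  have conj: "conjugate (conic_of_dual E) (abs_ppoint (a \<times> x)) (abs_ppoint (a \<times> y)) \<longleftrightarrow> (e \<bullet> x) * (e \<bullet> y) = 0"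
    if "a \<times> x \<noteq> 0" "a \<times> y \<noteq> 0" for x y
    unfolding conic_of_dual_def
    using that by (subst conjugate_abs) (simp_all add: form transpose_cof sym cof_neq_0[OF assms])
  have on: "\<exists>x. a \<times> x \<noteq> 0 \<and> q = abs_ppoint (a \<times> x)" if "lies_on q (abs_pline a)" for q
  proof -
    obtain v where v: "v \<noteq> 0" "q = abs_ppoint v" by (rule ppoint_rep)
    with that a0 have "v \<bullet> a = 0" by (simp add: lies_on_abs)
    from this a0 obtain x where "v = a \<times> x" by (rule orthogonal_imp_cross)
    with v show ?thesis by blast
  qed
  show ?thesis
  proof
    assume t: "tangent_at (conic_of_dual E) (abs_pline a) p"
    then obtain x where x: "a \<times> x \<noteq> 0" "p = abs_ppoint (a \<times> x)"
      using on by (auto simp: tangent_at_def)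
    have "a \<times> e \<noteq> 0" using ae a0 norm_and_cross_eq_0 by blast
    moreover have "lies_on (abs_ppoint (a \<times> e)) (abs_pline a)"
      using calculation a0 by (simp add: lies_on_abs dot_cross_self inner_commute)
    ultimately have "(e \<bullet> x) * (e \<bullet> e) = 0"
      using t x conj unfolding tangent_at_def by blast
    then have "e \<bullet> x = 0" using ae by simp
    then have "e \<times> (a \<times> x) = 0" using ae by (simp add: Lagrange inner_commute)
    then show "p = abs_ppoint (E *v a)"
      using x ae by (metis abs_ppoint_eq_iff e_def)
  next
    assume p: "p = abs_ppoint (E *v a)"
    have "e \<bullet> a = 0" using ae by (simp add: inner_commute)
    then obtain x where x: "e = a \<times> x" using a0 by (rule orthogonal_imp_cross)
    then have "e \<bullet> x = 0" by (simp add: dot_cross_self)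
    moreover have "lies_on p (abs_pline a)"
      using p ae a0 by (simp add: lies_on_abs e_def inner_commute)
    ultimately show "tangent_at (conic_of_dual E) (abs_pline a) p"
      unfolding tangent_at_def on_conic_def using p x ae conj on e_def by (metis mult_zero_left)
  qed
qed

lemma tangency_point_conic_of_dual:
  assumes "transpose E = E" "a \<bullet> (E *v a) = 0" "E *v a \<noteq> 0"
  shows "tangency_point (conic_of_dual E) (abs_pline a) = abs_ppoint (E *v a)"
  unfolding tangency_point_def
  by (rule the_equality) (simp_all add: tangent_at_conic_of_dual_iff[OF assms])

lemma nondegenerate_conic_of_dual:
  "cof E \<noteq> 0 \<Longrightarrow> transpose E = E \<Longrightarrow> nondegenerate (conic_of_dual E) \<longleftrightarrow> det E \<noteq> 0"
  by (simp add: conic_of_dual_def nondegenerate_abs transpose_cof det_cof)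

lemma nondegenerate_imp_conic_of_dual:
  assumes "nondegenerate C"
  obtains E where "transpose E = E" "det E \<noteq> 0" "C = conic_of_dual E"
proof -
  obtain A where A: "A \<noteq> 0" "transpose A = A" "C = abs_conic A" by (rule conic_rep)
  with assms have "det A \<noteq> 0" by (simp add: nondegenerate_abs)
  with A show thesis
    by (intro that[of "cof A"]) (simp_all add: transpose_cof det_cof conic_of_dual_def cof_cof abs_conic_scaleR)
qed

text \<open>
  Tangency at \<open>a \<times> x\<close> says by \<open>cof_form\<close> that \<open>E\<close> annihilates
  \<open>(a \<bullet> E a) x - (x \<bullet> E a) a\<close>. As \<open>E\<close> is invertible this vector is zero, while \<open>x\<close> and \<open>a\<close> are
  independent.
\<close>

lemma tangent_at_imp_isotropic:
  assumes sym: "transpose E = E" and det: "det E \<noteq> 0" and a0: "a \<noteq> 0"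
    and t: "tangent_at (conic_of_dual E) (abs_pline a) p"
  shows "a \<bullet> (E *v a) = 0"
proof -
  have "cof E \<noteq> 0" using det det_cof[of E] by (auto simp: det_3)
  obtain v where v: "v \<noteq> 0" "p = abs_ppoint v" by (rule ppoint_rep)
  with t a0 have "v \<bullet> a = 0" by (simp add: lies_on_abs tangent_at_def)
  from this a0 obtain x where x: "v = a \<times> x" by (rule orthogonal_imp_cross)
  \<comment> \<open>the vector that pairs with \<open>E y\<close> to the value of the conic at \<open>a \<times> x\<close> and \<open>a \<times> y\<close>\<close>
  define w where "w = (a \<bullet> (E *v a)) *\<^sub>R x - (x \<bullet> (E *v a)) *\<^sub>R a"
  have zero: "(a \<times> x) \<bullet> (cof E *v (a \<times> y)) = 0" for y
  proof (cases "a \<times> y = 0")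
    case False
    then have "lies_on (abs_ppoint (a \<times> y)) (abs_pline a)"
      using a0 by (simp add: lies_on_abs dot_cross_self inner_commute)
    then have "conjugate (conic_of_dual E) p (abs_ppoint (a \<times> y))"
      using t by (simp add: tangent_at_def)
    then show ?thesis
      using v x False sym \<open>cof E \<noteq> 0\<close> by (simp add: conic_of_dual_def conjugate_abs transpose_cof)
  qed simp
  have "y \<bullet> (E *v w) = (a \<times> x) \<bullet> (cof E *v (a \<times> y))" for y
    using symmetric_inner_commute[OF sym, of a y] symmetric_inner_commute[OF sym, of x y]
    by (simp add: w_def cof_form matrix_vector_mult_diff_distrib matrix_vector_mult_scaleR
        inner_diff_right)
  then have "(E *v w) \<bullet> (E *v w) = 0" using zero by metis
  then have "w = 0" using det_neq_0_imp_kernel[OF det] by simp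
  then have "a \<times> w = 0" by simp
  then have "(a \<bullet> (E *v a)) *\<^sub>R v = 0"
    by (simp add: w_def x Cross3.right_diff_distrib cross_mult_right)
  with v show ?thesis by simp
qed

text \<open>
  The Gram matrix of a basis of isotropic vectors has zero diagonal, so its determinant is twice
  the product of its three off-diagonal entries.
\<close>

lemma det_isotropic_basis:
  assumes sym: "transpose E = E"
    and iso: "a \<bullet> (E *v a) = 0" "b \<bullet> (E *v b) = 0" "c \<bullet> (E *v c) = 0"
  shows "det E * (bracket a b c)\<^sup>2 = 2 * (a \<bullet> (E *v b)) * (a \<bullet> (E *v c)) * (b \<bullet> (E *v c))"
proof -
  have "det E * (bracket a b c)\<^sup>2 = bracket a b c * bracket (E *v a) (E *v b) (E *v c)"
    by (simp add: bracket_matrix power2_eq_square)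
  also have "\<dots> = 2 * (a \<bullet> (E *v b)) * (a \<bullet> (E *v c)) * (b \<bullet> (E *v c))"
    using iso symmetric_inner_commute[OF sym, of b a] symmetric_inner_commute[OF sym, of c a]
      symmetric_inner_commute[OF sym, of c b] by (simp add: bracket_mult_bracket)
  finally show ?thesis .
qed

section \<open>The pencil of conics inscribed in a quadrilateral\<close>

text \<open>
  The dual form of the degenerate envelope consisting of all lines through \<open>p\<close> or through \<open>q\<close>.
\<close>

definition point_pair :: "real ^ 3 \<Rightarrow> real ^ 3 \<Rightarrow> real ^ 3 ^ 3" where
  "point_pair p q = (\<chi> i j. p $ i * q $ j + q $ i * p $ j)"

lemma point_pair_mult: "point_pair p q *v x = (q \<bullet> x) *\<^sub>R p + (p \<bullet> x) *\<^sub>R q"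
  by (simp add: point_pair_def vec_eq_iff matrix_vector_mult_def inner_vec_def sum_3 algebra_simps)

text \<open>
  The conic belonging to a pair of points is the double line joining them.
\<close>

lemma cof_point_pair: "cof (point_pair p q) = - (\<chi> i j. (p \<times> q) $ i * (p \<times> q) $ j)"
  by (simp add: cof_def point_pair_def vec_eq_iff forall_3 cross3_def algebra_simps)

text \<open>
  The edge-lines \<open>k, n, m, l\<close> of a quadrilateral, with opposite pairs \<open>k, m\<close> and \<open>l, n\<close>.
\<close>

definition quad :: "real ^ 3 \<Rightarrow> real ^ 3 \<Rightarrow> real ^ 3 \<Rightarrow> real ^ 3 \<Rightarrow> bool" where
  "quad k l m n \<longleftrightarrow>
     bracket k l m \<noteq> 0 \<and> bracket k l n \<noteq> 0 \<and> bracket k m n \<noteq> 0 \<and> bracket l m n \<noteq> 0"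

lemma bracket_neq_0_permute:
  assumes "bracket a b c \<noteq> 0"
  shows "bracket a c b \<noteq> 0" "bracket b a c \<noteq> 0" "bracket b c a \<noteq> 0"
    "bracket c a b \<noteq> 0" "bracket c b a \<noteq> 0"
  using assms bracket_rotate[of a b c] bracket_rotate[of b c a] bracket_rotate[of a c b]
    bracket_rotate[of c b a] bracket_swap[of a b c] by auto

lemma quad_swap: "quad k l m n \<Longrightarrow> quad l k n m"
  unfolding quad_def using bracket_neq_0_permute by metis

lemma quad_opposite: "quad k l m n \<Longrightarrow> quad m n k l"
  unfolding quad_def using bracket_neq_0_permute by metis

lemma quad_brackets:
  assumes "quad k l m n"
  shows
    "bracket k l m \<noteq> 0" "bracket k m l \<noteq> 0" "bracket l k m \<noteq> 0" "bracket l m k \<noteq> 0"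
    "bracket m k l \<noteq> 0" "bracket m l k \<noteq> 0" "bracket k l n \<noteq> 0" "bracket k n l \<noteq> 0"
    "bracket l k n \<noteq> 0" "bracket l n k \<noteq> 0" "bracket n k l \<noteq> 0" "bracket n l k \<noteq> 0"
    "bracket k m n \<noteq> 0" "bracket k n m \<noteq> 0" "bracket m k n \<noteq> 0" "bracket m n k \<noteq> 0"
    "bracket n k m \<noteq> 0" "bracket n m k \<noteq> 0" "bracket l m n \<noteq> 0" "bracket l n m \<noteq> 0"
    "bracket m l n \<noteq> 0" "bracket m n l \<noteq> 0" "bracket n l m \<noteq> 0" "bracket n m l \<noteq> 0"
proof -
  have nz: "bracket k l m \<noteq> 0" "bracket k l n \<noteq> 0" "bracket k m n \<noteq> 0" "bracket l m n \<noteq> 0"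
    using assms by (simp_all add: quad_def)
  note nz nz[THEN bracket_neq_0_permute(1)] nz[THEN bracket_neq_0_permute(2)]
    nz[THEN bracket_neq_0_permute(3)] nz[THEN bracket_neq_0_permute(4)]
    nz[THEN bracket_neq_0_permute(5)]
  then show
    "bracket k l m \<noteq> 0" "bracket k m l \<noteq> 0" "bracket l k m \<noteq> 0" "bracket l m k \<noteq> 0"
    "bracket m k l \<noteq> 0" "bracket m l k \<noteq> 0" "bracket k l n \<noteq> 0" "bracket k n l \<noteq> 0"
    "bracket l k n \<noteq> 0" "bracket l n k \<noteq> 0" "bracket n k l \<noteq> 0" "bracket n l k \<noteq> 0"
    "bracket k m n \<noteq> 0" "bracket k n m \<noteq> 0" "bracket m k n \<noteq> 0" "bracket m n k \<noteq> 0"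
    "bracket n k m \<noteq> 0" "bracket n m k \<noteq> 0" "bracket l m n \<noteq> 0" "bracket l n m \<noteq> 0"
    "bracket m l n \<noteq> 0" "bracket m n l \<noteq> 0" "bracket n l m \<noteq> 0" "bracket n m l \<noteq> 0"
    by simp_all
qed

lemma quad_neq_0:
  assumes "quad k l m n"
  shows
    "k \<noteq> 0" "l \<noteq> 0" "m \<noteq> 0" "n \<noteq> 0"
    "k \<times> l \<noteq> 0" "k \<times> m \<noteq> 0" "k \<times> n \<noteq> 0" "l \<times> k \<noteq> 0" "l \<times> m \<noteq> 0" "l \<times> n \<noteq> 0"
    "m \<times> k \<noteq> 0" "m \<times> l \<noteq> 0" "m \<times> n \<noteq> 0" "n \<times> k \<noteq> 0" "n \<times> l \<noteq> 0" "n \<times> m \<noteq> 0"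
proof -
  have "bracket k l m \<noteq> 0" "bracket k m n \<noteq> 0" "bracket l m n \<noteq> 0"
    using assms by (simp_all add: quad_def)
  note this[THEN bracket_neq_0_imp(1)] this[THEN bracket_neq_0_imp(2)] this[THEN bracket_neq_0_imp(3)]
    this[THEN bracket_neq_0_imp(4)] this[THEN bracket_neq_0_imp(5)] this[THEN bracket_neq_0_imp(6)]
    this[THEN bracket_neq_0_imp(7)] this[THEN bracket_neq_0_imp(8)] this[THEN bracket_neq_0_imp(9)]
  then show
    "k \<noteq> 0" "l \<noteq> 0" "m \<noteq> 0" "n \<noteq> 0"
    "k \<times> l \<noteq> 0" "k \<times> m \<noteq> 0" "k \<times> n \<noteq> 0" "l \<times> k \<noteq> 0" "l \<times> m \<noteq> 0" "l \<times> n \<noteq> 0"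
    "m \<times> k \<noteq> 0" "m \<times> l \<noteq> 0" "m \<times> n \<noteq> 0" "n \<times> k \<noteq> 0" "n \<times> l \<noteq> 0" "n \<times> m \<noteq> 0"
    by simp_all
qed

text \<open>
  Spanned by the two pairs of opposite vertices. The symmetries of the quadrilateral that fix
  each diagonal leave the pencil fixed, parameters included; facts about the edge-line \<open>k\<close> thus
  transfer to the other three.
\<close>

definition pencil :: "real ^ 3 \<Rightarrow> real ^ 3 \<Rightarrow> real ^ 3 \<Rightarrow> real ^ 3 \<Rightarrow> real \<Rightarrow> real \<Rightarrow> real ^ 3 ^ 3" where
  "pencil k l m n \<alpha> \<beta> = \<alpha> *\<^sub>R point_pair (k \<times> l) (m \<times> n) + \<beta> *\<^sub>R point_pair (k \<times> n) (m \<times> l)"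

lemma transpose_pencil: "transpose (pencil k l m n \<alpha> \<beta>) = pencil k l m n \<alpha> \<beta>"
  by (simp add: pencil_def point_pair_def transpose_def vec_eq_iff algebra_simps)

lemma pencil_swap: "pencil l k n m \<alpha> \<beta> = pencil k l m n \<alpha> \<beta>"
  using cross_skew[of l k] cross_skew[of n m] cross_skew[of l m] cross_skew[of n k]
  by (simp add: pencil_def point_pair_def vec_eq_iff algebra_simps)

lemma pencil_opposite: "pencil m n k l \<alpha> \<beta> = pencil k l m n \<alpha> \<beta>"
  by (simp add: pencil_def point_pair_def vec_eq_iff algebra_simps)

lemma pencil_scaleR: "pencil k l m n (c * \<alpha>) (c * \<beta>) = c *\<^sub>R pencil k l m n \<alpha> \<beta>"
  by (simp add: pencil_def algebra_simps)

lemma pencil_mult: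
  "pencil k l m n \<alpha> \<beta> *v x =
     \<alpha> *\<^sub>R (bracket m n x *\<^sub>R (k \<times> l) + bracket k l x *\<^sub>R (m \<times> n)) +
     \<beta> *\<^sub>R (bracket m l x *\<^sub>R (k \<times> n) + bracket k n x *\<^sub>R (m \<times> l))"
  by (simp add: pencil_def matrix_vector_mult_add_rdistrib point_pair_mult bracket_def
      flip: scaleR_matrix_vector_assoc)

lemma pencil_form:
  "x \<bullet> (pencil k l m n \<alpha> \<beta> *v y) =
     \<alpha> * (bracket m n y * bracket k l x + bracket k l y * bracket m n x) +
     \<beta> * (bracket m l y * bracket k n x + bracket k n y * bracket m l x)"
  by (simp add: pencil_mult bracket_def inner_add_right inner_commute)

lemma pencil_mult_edge:
  "pencil k l m n \<alpha> \<beta> *v k =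
     (\<alpha> * bracket m n k) *\<^sub>R (k \<times> l) + (\<beta> * bracket m l k) *\<^sub>R (k \<times> n)"
  by (simp add: pencil_mult)

lemma pencil_isotropic:
  "k \<bullet> (pencil k l m n \<alpha> \<beta> *v k) = 0" "l \<bullet> (pencil k l m n \<alpha> \<beta> *v l) = 0"
  "m \<bullet> (pencil k l m n \<alpha> \<beta> *v m) = 0" "n \<bullet> (pencil k l m n \<alpha> \<beta> *v n) = 0"
  by (simp_all add: pencil_form)

lemma pencil_mult_edge_neq_0:
  assumes "quad k l m n" "\<alpha> \<noteq> 0 \<or> \<beta> \<noteq> 0"
  shows "pencil k l m n \<alpha> \<beta> *v k \<noteq> 0"
proof
  assume z: "pencil k l m n \<alpha> \<beta> *v k = 0"
  have "bracket k l n \<noteq> 0" "bracket k n l \<noteq> 0" "bracket m n k \<noteq> 0" "bracket m l k \<noteq> 0"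
    using assms by (auto simp: quad_brackets)
  moreover have "n \<bullet> (pencil k l m n \<alpha> \<beta> *v k) = \<alpha> * bracket m n k * bracket k l n"
    "l \<bullet> (pencil k l m n \<alpha> \<beta> *v k) = \<beta> * bracket m l k * bracket k n l"
    by (simp_all add: pencil_form)
  ultimately show False using z assms(2) by auto
qed

text \<open>
  The three degenerate members of the pencil are the three pairs of opposite vertices of the
  complete quadrilateral. In the isotropic basis \<open>k, l, m\<close> the three Gram entries are multiples of
  \<open>\<beta>\<close>, \<open>\<alpha> + \<beta>\<close> and \<open>\<alpha>\<close>.
\<close>

lemma det_pencil_neq_0_iff:
  assumes "quad k l m n"
  shows "det (pencil k l m n \<alpha> \<beta>) \<noteq> 0 \<longleftrightarrow> \<alpha> \<noteq> 0 \<and> \<beta> \<noteq> 0 \<and> \<alpha> + \<beta> \<noteq> 0"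
proof -
  let ?E = "pencil k l m n \<alpha> \<beta>"
  have nz: "bracket k l m \<noteq> 0" "bracket k n l \<noteq> 0" "bracket m l k \<noteq> 0" "bracket m n k \<noteq> 0" "bracket m n l \<noteq> 0"
    using assms by (auto simp: quad_brackets)
  have "bracket k l m = - bracket m l k" "bracket k n m = - bracket m n k"
    by (metis bracket_rotate bracket_swap)+
  then have "k \<bullet> (?E *v m) = - ((\<alpha> + \<beta>) * bracket m l k * bracket m n k)"
    by (simp add: pencil_form algebra_simps)
  moreover have "k \<bullet> (?E *v l) = \<beta> * bracket k n l * bracket m l k"
    "l \<bullet> (?E *v m) = \<alpha> * bracket k l m * bracket m n l"
    by (simp_all add: pencil_form)
  moreover have "det ?E * (bracket k l m)\<^sup>2 = 2 * (k \<bullet> (?E *v l)) * (k \<bullet> (?E *v m)) * (l \<bullet> (?E *v m))"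
    by (intro det_isotropic_basis transpose_pencil pencil_isotropic)
  ultimately have "det ?E * (bracket k l m)\<^sup>2 =
     - 2 * (\<beta> * bracket k n l * bracket m l k) * ((\<alpha> + \<beta>) * bracket m l k * bracket m n k) * (\<alpha> * bracket k l m * bracket m n l)"
    by simp
  then have "det ?E = 0 \<longleftrightarrow>
     - 2 * (\<beta> * bracket k n l * bracket m l k) * ((\<alpha> + \<beta>) * bracket m l k * bracket m n k) * (\<alpha> * bracket k l m * bracket m n l) = 0"
    using nz by (metis mult_eq_0_iff power_eq_0_iff)
  then show ?thesis using nz by auto
qed

lemma orthogonal_basis_imp_0:
  assumes "bracket a b c \<noteq> 0" "a \<bullet> v = 0" "b \<bullet> v = 0" "c \<bullet> v = 0"
  shows "v = 0"
proof -
  have "bracket a b c *\<^sub>R v \<bullet> v = 0"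
    by (subst bracket_cramer[of a b c v]) (simp add: inner_add_left assms)
  then show ?thesis using assms by simp
qed

text \<open>
  In the basis \<open>k, l, m\<close> a form isotropic on these lines has three free entries, and isotropy on
  \<open>n\<close> is one linear relation between them. The parameters \<open>\<alpha>, \<beta>\<close> are chosen so as to match two of
  the entries; the relation then forces the third.
\<close>

lemma isotropic_imp_pencil:
  assumes q: "quad k l m n" and sym: "transpose E = E"
    and iso: "k \<bullet> (E *v k) = 0" "l \<bullet> (E *v l) = 0" "m \<bullet> (E *v m) = 0" "n \<bullet> (E *v n) = 0"
  obtains \<alpha> \<beta> where "E = pencil k l m n \<alpha> \<beta>"
proof
  have nz: "bracket k l m \<noteq> 0" "bracket k n l \<noteq> 0" "bracket m l k \<noteq> 0" "bracket m n l \<noteq> 0"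
    "bracket n l m \<noteq> 0" "bracket k l n \<noteq> 0"
    using q by (auto simp: quad_brackets)
  \<comment> \<open>in the pencil the entry of \<open>l, m\<close> involves only \<open>\<alpha>\<close> and that of \<open>k, l\<close> only \<open>\<beta>\<close>\<close>
  define \<alpha> where "\<alpha> = l \<bullet> (E *v m) / (bracket k l m * bracket m n l)"
  define \<beta> where "\<beta> = k \<bullet> (E *v l) / (bracket k n l * bracket m l k)"
  define F where "F = E - pencil k l m n \<alpha> \<beta>"
  have symF: "transpose F = F"
    using sym transpose_pencil[of k l m n \<alpha> \<beta>] by (simp add: F_def transpose_def vec_eq_iff)
  note comm = symmetric_inner_commute[OF symF]
  have F: "F *v x = E *v x - pencil k l m n \<alpha> \<beta> *v x" for x
    by (simp add: F_def matrix_vector_mult_diff_rdistrib)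
  have isoF: "k \<bullet> (F *v k) = 0" "l \<bullet> (F *v l) = 0" "m \<bullet> (F *v m) = 0" "n \<bullet> (F *v n) = 0"
    using iso by (simp_all add: F inner_diff_right pencil_isotropic)
  have kl: "k \<bullet> (F *v l) = 0"
    using nz by (simp add: F inner_diff_right pencil_form \<beta>_def)
  have lm: "l \<bullet> (F *v m) = 0"
    using nz by (simp add: F inner_diff_right pencil_form \<alpha>_def)
  have km: "k \<bullet> (F *v m) = 0"
  proof -
    let ?x = "bracket n l m" and ?y = "bracket k n m" and ?z = "bracket k l n"
    have "0 = (bracket k l m *\<^sub>R n) \<bullet> (F *v (bracket k l m *\<^sub>R n))"
      using isoF by (simp add: matrix_vector_mult_scaleR)
    also have "\<dots> = 2 * ?x * ?z * (k \<bullet> (F *v m))"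
      unfolding bracket_cramer[of k l m n]
      using isoF kl lm comm[of l k] comm[of m l] comm[of m k]
      by (simp add: matrix_vector_right_distrib matrix_vector_mult_scaleR inner_add_left inner_add_right)
    finally show ?thesis using nz by simp
  qed
  have ker: "F *v k = 0" "F *v l = 0" "F *v m = 0"
    using isoF kl lm km comm[of l k] comm[of m l] comm[of m k]
    by (simp_all add: orthogonal_basis_imp_0[OF nz(1)])
  have "F *v x = 0" for x
  proof -
    have "bracket k l m *\<^sub>R (F *v x) = F *v (bracket k l m *\<^sub>R x)"
      by (simp add: matrix_vector_mult_scaleR)
    also have "\<dots> = 0"
      by (simp add: bracket_cramer[of k l m x] matrix_vector_right_distrib matrix_vector_mult_scaleR ker)
    finally show ?thesis using nz by simp
  qed
  then have "F = 0" by (simp add: matrix_eq)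
  then show "E = pencil k l m n \<alpha> \<beta>" by (simp add: F_def)
qed

text \<open>
  A three-term Grassmann-Pluecker relation between the three pairs of opposite vertices of the
  complete quadrilateral.
\<close>

lemma pencil_degenerate: "pencil k l m n (- 1) 1 = - point_pair (k \<times> m) (l \<times> n)"
  by (simp add: pencil_def point_pair_def vec_eq_iff forall_3 cross3_def algebra_simps)

text \<open>
  Setting the second parameter of the pencil to one leaves out the vertex pair
  \<open>k \<inter> l, m \<inter> n\<close>; the other vertex pair is \<open>t = 0\<close>.
\<close>

definition inconic :: "real ^ 3 \<Rightarrow> real ^ 3 \<Rightarrow> real ^ 3 \<Rightarrow> real ^ 3 \<Rightarrow> real \<Rightarrow> conic" where
  "inconic k l m n t = conic_of_dual (pencil k l m n t 1)"

lemma inconic_swap: "inconic l k n m t = inconic k l m n t"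
  by (simp add: inconic_def pencil_swap)

lemma inconic_opposite: "inconic m n k l t = inconic k l m n t"
  by (simp add: inconic_def pencil_opposite)

lemma cof_pencil_neq_0:
  assumes "quad k l m n" "\<alpha> \<noteq> 0 \<or> \<beta> \<noteq> 0"
  shows "cof (pencil k l m n \<alpha> \<beta>) \<noteq> 0"
  by (rule cof_neq_0[OF transpose_pencil pencil_isotropic(1) pencil_mult_edge_neq_0[OF assms]])

lemma conic_of_dual_pencil:
  assumes "quad k l m n" "\<beta> \<noteq> 0"
  shows "conic_of_dual (pencil k l m n \<alpha> \<beta>) = inconic k l m n (\<alpha> / \<beta>)"
proof -
  have "pencil k l m n \<alpha> \<beta> = \<beta> *\<^sub>R pencil k l m n (\<alpha> / \<beta>) 1"
    using assms by (simp flip: pencil_scaleR)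
  then show ?thesis
    using assms cof_pencil_neq_0[OF assms(1), of "\<alpha> / \<beta>" 1]
    by (simp add: inconic_def conic_of_dual_def cof_scaleR abs_conic_scaleR transpose_cof transpose_pencil)
qed

lemma tangency_point_inconic:
  assumes "quad k l m n"
  shows "tangency_point (inconic k l m n t) (abs_pline k) = abs_ppoint (pencil k l m n t 1 *v k)"
  unfolding inconic_def using assms
  by (intro tangency_point_conic_of_dual transpose_pencil pencil_isotropic pencil_mult_edge_neq_0) auto

lemma cross_cross_common: "(k \<times> l) \<times> (k \<times> n) = bracket k l n *\<^sub>R k"
  by (simp add: Lagrange bracket_def dot_cross_self inner_commute)

text \<open>
  The vertices on \<open>k\<close> are excluded by the nonzero coefficients, the other two by not lying on
  \<open>k\<close>.
\<close>

lemma edge_point_not_vertex: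
  assumes q: "quad k l m n" and "x \<noteq> 0" "y \<noteq> 0"
  shows "abs_ppoint (x *\<^sub>R (k \<times> l) + y *\<^sub>R (k \<times> n)) \<notin>
    vertices (abs_pline k) (abs_pline l) (abs_pline m) (abs_pline n)"
proof -
  let ?p = "x *\<^sub>R (k \<times> l) + y *\<^sub>R (k \<times> n)"
  have nz: "bracket k l n \<noteq> 0" "bracket k n l \<noteq> 0" "bracket m n k \<noteq> 0" "bracket m l k \<noteq> 0"
    using q by (auto simp: quad_brackets)
  have c: "k \<times> l \<noteq> 0" "k \<times> n \<noteq> 0" "m \<times> n \<noteq> 0" "m \<times> l \<noteq> 0" "k \<noteq> 0"
    using quad_neq_0[OF q] by simp_all
  have pl: "?p \<times> (k \<times> l) \<noteq> 0" and pn: "?p \<times> (k \<times> n) \<noteq> 0"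
    using nz c assms by (simp_all add: cross_add_left cross_mult_left cross_cross_common)
  then have p0: "?p \<noteq> 0" by auto
  have "lies_on (abs_ppoint ?p) (abs_pline k)"
    using p0 c by (simp add: lies_on_abs inner_add_left dot_cross_self)
  moreover have "\<not> lies_on (abs_ppoint (m \<times> n)) (abs_pline k)"
    "\<not> lies_on (abs_ppoint (m \<times> l)) (abs_pline k)"
    using nz c by (simp_all add: lies_on_abs bracket_def)
  ultimately have "abs_ppoint ?p \<noteq> abs_ppoint (m \<times> n)" "abs_ppoint ?p \<noteq> abs_ppoint (m \<times> l)"
    by metis+
  moreover have "abs_ppoint ?p \<noteq> abs_ppoint (k \<times> l)" "abs_ppoint ?p \<noteq> abs_ppoint (k \<times> n)"
    using p0 c pl pn by (simp_all add: abs_ppoint_eq_iff)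
  ultimately show ?thesis
    using c by (simp add: vertices_def meet_abs)
qed

lemma vertices_swap: "vertices l k n m = vertices k l m n"
  unfolding vertices_def by (simp add: meet_commute insert_commute)

lemma vertices_opposite: "vertices m n k l = vertices k l m n"
  unfolding vertices_def by auto

lemma inconic_tangent_not_vertex:
  assumes q: "quad k l m n" and t: "t \<noteq> 0"
  shows "\<exists>p. tangent_at (inconic k l m n t) (abs_pline k) p \<and>
    p \<notin> vertices (abs_pline k) (abs_pline l) (abs_pline m) (abs_pline n)"
proof -
  have nz: "bracket m n k \<noteq> 0" "bracket m l k \<noteq> 0"
    using q by (auto simp: quad_brackets)
  have "tangent_at (inconic k l m n t) (abs_pline k) (abs_ppoint (pencil k l m n t 1 *v k))"
    unfolding inconic_def
    by (simp add: tangent_at_conic_of_dual_iff transpose_pencil pencil_isotropic pencil_mult_edge_neq_0[OF q])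
  moreover have "abs_ppoint (pencil k l m n t 1 *v k) \<notin>
      vertices (abs_pline k) (abs_pline l) (abs_pline m) (abs_pline n)"
    unfolding pencil_mult_edge using nz t by (intro edge_point_not_vertex[OF q]) auto
  ultimately show ?thesis by blast
qed

lemma inconic_degenerate:
  assumes q: "quad k l m n"
  shows "inconic k l m n (- 1) =
    double_line (join (meet (abs_pline k) (abs_pline m)) (meet (abs_pline l) (abs_pline n)))"
proof -
  let ?a = "(k \<times> m) \<times> (l \<times> n)"
  have nz: "k \<times> m \<noteq> 0" "l \<times> n \<noteq> 0"
    using quad_neq_0[OF q] by simp_all
  have cof: "cof (pencil k l m n (- 1) 1) = (- 1) *\<^sub>R (\<chi> i j. ?a $ i * ?a $ j)"
  proof -
    have "cof (- M) = cof M" for M using cof_scaleR[of "-1" M] by simp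
    then show ?thesis by (simp add: pencil_degenerate cof_point_pair)
  qed
  have "cof (pencil k l m n (- 1) 1) \<noteq> 0" using q by (simp add: cof_pencil_neq_0)
  then have d0: "(\<chi> i j. ?a $ i * ?a $ j) \<noteq> 0" using cof by auto
  then have "?a \<noteq> 0" by (auto simp: vec_eq_iff)
  moreover have "inconic k l m n (- 1) = abs_conic (\<chi> i j. ?a $ i * ?a $ j)"
    unfolding inconic_def conic_of_dual_def cof
    by (rule abs_conic_scaleR) (use d0 in \<open>simp_all add: transpose_def vec_eq_iff\<close>)
  ultimately show ?thesis using nz by (simp add: meet_abs join_abs double_line_abs)
qed

text \<open>
  A nondegenerate inscribed conic has its dual form in the pencil, with both parameters nonzero
  since the form is invertible. Conversely only \<open>t = -1\<close> degenerates, and it gives precisely the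
  admitted double line.
\<close>

lemma inscribed_iff_inconic:
  assumes q: "quad k l m n"
  shows "inscribed (abs_pline k) (abs_pline l) (abs_pline m) (abs_pline n) C \<longleftrightarrow>
    (\<exists>t. t \<noteq> 0 \<and> C = inconic k l m n t)"
proof
  assume "inscribed (abs_pline k) (abs_pline l) (abs_pline m) (abs_pline n) C"
  then consider (smooth) "nondegenerate C"
      "\<forall>a \<in> {abs_pline k, abs_pline n, abs_pline m, abs_pline l}. \<exists>p. tangent_at C a p"
    | (double) "C = inconic k l m n (- 1)"
    unfolding inscribed_def inconic_degenerate[OF q] by blast
  then show "\<exists>t. t \<noteq> 0 \<and> C = inconic k l m n t"
  proof cases
    case smooth
    obtain E where E: "transpose E = E" "det E \<noteq> 0" "C = conic_of_dual E"
      using smooth(1) by (rule nondegenerate_imp_conic_of_dual)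
    have nz: "k \<noteq> 0" "l \<noteq> 0" "m \<noteq> 0" "n \<noteq> 0"
      using quad_neq_0[OF q] by simp_all
    have "a \<bullet> (E *v a) = 0" if "a \<in> {k, l, m, n}" for a
      using that smooth(2) nz E tangent_at_imp_isotropic[OF E(1,2), of a] by blast
    then obtain \<alpha> \<beta> where "E = pencil k l m n \<alpha> \<beta>"
      using isotropic_imp_pencil[OF q E(1)] by blast
    moreover from this have "\<alpha> \<noteq> 0" "\<beta> \<noteq> 0" using E(2) det_pencil_neq_0_iff[OF q] by auto
    ultimately show ?thesis
      using E(3) conic_of_dual_pencil[OF q] by (intro exI[of _ "\<alpha> / \<beta>"]) auto
  next
    case double
    then show ?thesis by (intro exI[of _ "- 1"]) simp
  qed
next
  assume "\<exists>t. t \<noteq> 0 \<and> C = inconic k l m n t"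
  then obtain t where t: "t \<noteq> 0" "C = inconic k l m n t" by blast
  show "inscribed (abs_pline k) (abs_pline l) (abs_pline m) (abs_pline n) C"
  proof (cases "t = - 1")
    case True
    then show ?thesis using t inconic_degenerate[OF q] by (simp add: inscribed_def)
  next
    case False
    then have "nondegenerate C"
      using t q unfolding t(2) inconic_def
      by (subst nondegenerate_conic_of_dual) (auto simp: cof_pencil_neq_0 transpose_pencil det_pencil_neq_0_iff)
    moreover note inconic_tangent_not_vertex[OF q t(1)]
      inconic_tangent_not_vertex[OF quad_swap[OF q] t(1)]
      inconic_tangent_not_vertex[OF quad_opposite[OF q] t(1)]
      inconic_tangent_not_vertex[OF quad_swap[OF quad_opposite[OF q]] t(1)]
    ultimately show ?thesis
      unfolding inscribed_def t(2)
      by (simp add: inconic_swap inconic_opposite vertices_swap vertices_opposite)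
  qed
qed

section \<open>Touching conics\<close>

lemma abs_ppoint_combination_eq_iff:
  assumes "u \<times> v \<noteq> 0" "x *\<^sub>R u + y *\<^sub>R v \<noteq> 0" "x' *\<^sub>R u + y' *\<^sub>R v \<noteq> 0"
  shows "abs_ppoint (x *\<^sub>R u + y *\<^sub>R v) = abs_ppoint (x' *\<^sub>R u + y' *\<^sub>R v) \<longleftrightarrow> x * y' = y * x'"
proof -
  have "(x *\<^sub>R u + y *\<^sub>R v) \<times> (x' *\<^sub>R u + y' *\<^sub>R v) = (x * y' - y * x') *\<^sub>R (u \<times> v)"
    using cross_skew[of v u]
    by (simp add: cross_add_left cross_add_right cross_mult_left cross_mult_right algebra_simps)
  then show ?thesis using assms by (simp add: abs_ppoint_eq_iff)
qed

text \<open>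
  The two quadrilaterals share the edge on \<open>m\<close>. Both tangency points are combinations of its
  endpoints \<open>m \<inter> n\<close> and \<open>m \<inter> l\<close>; the parameter \<open>t\<close> multiplies the coefficient of the former, \<open>t'\<close>
  that of the latter, because \<open>m \<inter> n\<close> belongs to the first vertex pair of one quadrilateral
  and \<open>m \<inter> l\<close> to that of the other. That is why the condition is on the product rather than on
  the quotient of the parameters.
\<close>

lemma touching_iff:
  assumes q1: "quad k l m n" and q2: "quad m l q n"
  shows "tangency_point (inconic k l m n t) (abs_pline m) = tangency_point (inconic m l q n t') (abs_pline m)
    \<longleftrightarrow> t * t' * (bracket k l m * bracket q n m) = bracket k n m * bracket q l m"
proof -
  have "tangency_point (inconic k l m n t) (abs_pline m) = abs_ppoint (pencil m n k l t 1 *v m)"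
    using tangency_point_inconic[OF quad_opposite[OF q1]] by (simp add: inconic_opposite)
  moreover have "tangency_point (inconic m l q n t') (abs_pline m) = abs_ppoint (pencil m l q n t' 1 *v m)"
    by (rule tangency_point_inconic[OF q2])
  moreover have p1: "pencil m n k l t 1 *v m = (t * bracket k l m) *\<^sub>R (m \<times> n) + bracket k n m *\<^sub>R (m \<times> l)"
    by (simp add: pencil_mult_edge)
  moreover have p2: "pencil m l q n t' 1 *v m = bracket q l m *\<^sub>R (m \<times> n) + (t' * bracket q n m) *\<^sub>R (m \<times> l)"
    by (simp add: pencil_mult_edge add.commute)
  moreover have "(m \<times> n) \<times> (m \<times> l) \<noteq> 0"
    using quad_brackets[OF q2] quad_neq_0[OF q2] by (simp add: cross_cross_common)
  moreover have "pencil m n k l t 1 *v m \<noteq> 0" "pencil m l q n t' 1 *v m \<noteq> 0"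
    using pencil_mult_edge_neq_0[OF quad_opposite[OF q1]] pencil_mult_edge_neq_0[OF q2] by simp_all
  ultimately have "tangency_point (inconic k l m n t) (abs_pline m) = tangency_point (inconic m l q n t') (abs_pline m)
      \<longleftrightarrow> (t * bracket k l m) * (t' * bracket q n m) = bracket k n m * bracket q l m"
    by (simp add: abs_ppoint_combination_eq_iff)
  then show ?thesis by (simp add: ac_simps)
qed

text \<open>
  The tangency point is a combination of the endpoints of the edge in which one coefficient is
  proportional to \<open>t\<close>, so it runs once through all points other than the endpoints.
\<close>

lemma edge_point_parameter:
  assumes q: "quad k l m n" and p: "lies_on p (abs_pline k)"
    "p \<noteq> meet (abs_pline k) (abs_pline l)" "p \<noteq> meet (abs_pline k) (abs_pline n)"
  obtains s where "s \<noteq> 0" "\<forall>t. tangency_point (inconic k l m n t) (abs_pline k) = p \<longleftrightarrow> t = s"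
proof -
  note nz = quad_brackets[OF q]
  have c: "k \<times> l \<noteq> 0" "k \<times> n \<noteq> 0" "k \<noteq> 0" using quad_neq_0[OF q] by simp_all
  have cc: "(k \<times> l) \<times> (k \<times> n) \<noteq> 0" using nz c by (simp add: cross_cross_common)
  obtain v where v: "v \<noteq> 0" "p = abs_ppoint v" by (rule ppoint_rep)
  have vk: "v \<bullet> k = 0" using p(1) v c by (simp add: lies_on_abs)
  define x where "x = (v \<bullet> n) / bracket k l n"
  define y where "y = (v \<bullet> l) / bracket k n l"
  have veq: "v = x *\<^sub>R (k \<times> l) + y *\<^sub>R (k \<times> n)"
  proof -
    have "v - (x *\<^sub>R (k \<times> l) + y *\<^sub>R (k \<times> n)) = 0"
    proof (rule orthogonal_basis_imp_0)
      show "bracket k l n \<noteq> 0" by (rule nz)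
      show "k \<bullet> (v - (x *\<^sub>R (k \<times> l) + y *\<^sub>R (k \<times> n))) = 0"
        using vk by (simp add: inner_diff_right inner_add_right dot_cross_self inner_commute)
      show "l \<bullet> (v - (x *\<^sub>R (k \<times> l) + y *\<^sub>R (k \<times> n))) = 0"
        using nz by (simp add: inner_diff_right inner_add_right dot_cross_self y_def bracket_def inner_commute)
      show "n \<bullet> (v - (x *\<^sub>R (k \<times> l) + y *\<^sub>R (k \<times> n))) = 0"
        using nz by (simp add: inner_diff_right inner_add_right dot_cross_self x_def bracket_def inner_commute)
    qed
    then show ?thesis by simp
  qed
  have x0: "x \<noteq> 0" and y0: "y \<noteq> 0"
    using p(2,3) v c veq by (auto simp: meet_abs abs_ppoint_scaleR)
  define s where "s = (x * bracket m l k) / (y * bracket m n k)"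
  have "tangency_point (inconic k l m n t) (abs_pline k) = p \<longleftrightarrow> t = s" for t
  proof -
    have "pencil k l m n t 1 *v k \<noteq> 0" using q by (simp add: pencil_mult_edge_neq_0)
    then have "tangency_point (inconic k l m n t) (abs_pline k) = p \<longleftrightarrow>
        (t * bracket m n k) * y = bracket m l k * x"
      using v cc unfolding tangency_point_inconic[OF q] v(2) veq pencil_mult_edge
      by (subst abs_ppoint_combination_eq_iff) auto
    then show ?thesis using x0 y0 nz by (simp add: s_def field_simps)
  qed
  moreover have "s \<noteq> 0" using x0 y0 nz by (simp add: s_def)
  ultimately show thesis using that by blast
qed

section \<open>Diagonal points\<close>

lemma cross_cross_bracket:
  "(a \<times> b) \<times> (c \<times> d) = bracket a b d *\<^sub>R c - bracket a b c *\<^sub>R d"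
  by (simp add: bracket_def vec_eq_iff forall_3 cross3_def inner_vec_def sum_3 algebra_simps)

lemma bracket_perms:
  "bracket b c a = bracket a b c" "bracket c a b = bracket a b c"
  "bracket b a c = - bracket a b c" "bracket a c b = - bracket a b c" "bracket c b a = - bracket a b c"
  by (metis bracket_rotate bracket_swap)+

lemma bracket_crosses:
  "bracket (a \<times> b) (c \<times> d) (e \<times> f) = bracket a b d * bracket e f c - bracket a b c * bracket e f d"
  unfolding bracket_def[of "a \<times> b"] cross_cross_bracket
  by (simp add: inner_diff_left bracket_def inner_commute[of c] inner_commute[of d])

text \<open>
  The dependencies between the four vertices. They suffice for all computations with diagonal
  points and chords below.
\<close>

lemma bracket_vertices:
  "bracket (k \<times> l) (m \<times> n) (k \<times> n) = - (bracket k l n * bracket k m n)"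
  "bracket (k \<times> l) (m \<times> n) (m \<times> l) = bracket k l m * bracket l m n"
  "bracket (k \<times> l) (k \<times> n) (m \<times> l) = - (bracket k l m * bracket k l n)"
  "bracket (m \<times> n) (k \<times> n) (m \<times> l) = bracket k m n * bracket l m n"
  by (simp_all add: bracket_crosses bracket_perms[where a = k and b = l and c = m] bracket_perms[where a = k and b = l and c = n]
      bracket_perms[where a = k and b = m and c = n] bracket_perms[where a = l and b = m and c = n])

definition diagonal_vector :: "real ^ 3 \<Rightarrow> real ^ 3 \<Rightarrow> real ^ 3 \<Rightarrow> real ^ 3 \<Rightarrow> real ^ 3" where
  "diagonal_vector k l m n = ((k \<times> l) \<times> (m \<times> n)) \<times> ((k \<times> n) \<times> (m \<times> l))"

text \<open>
  The intersection of the diagonals written in the endpoints of one diagonal, and in the next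
  lemma in those of the other one.
\<close>

lemma diagonal_vector_eq:
  "diagonal_vector k l m n =
     (bracket k l m * bracket l m n) *\<^sub>R (k \<times> n) + (bracket k l n * bracket k m n) *\<^sub>R (m \<times> l)"
  unfolding diagonal_vector_def cross_cross_bracket[of "k \<times> l" "m \<times> n"]
  by (simp add: bracket_vertices)

lemma diagonal_vector_eq':
  "diagonal_vector k l m n =
     (- (bracket k m n * bracket l m n)) *\<^sub>R (k \<times> l) + (- (bracket k l m * bracket k l n)) *\<^sub>R (m \<times> n)"
proof -
  have "diagonal_vector k l m n = - (((k \<times> n) \<times> (m \<times> l)) \<times> ((k \<times> l) \<times> (m \<times> n)))"
    unfolding diagonal_vector_def by (rule cross_skew)
  also have "\<dots> = - (bracket (k \<times> n) (m \<times> l) (m \<times> n) *\<^sub>R (k \<times> l) - bracket (k \<times> n) (m \<times> l) (k \<times> l) *\<^sub>R (m \<times> n))"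
    unfolding cross_cross_bracket[of "k \<times> n" "m \<times> l" "k \<times> l" "m \<times> n"] ..
  also have "bracket (k \<times> n) (m \<times> l) (m \<times> n) = bracket k m n * bracket l m n"
    by (metis bracket_rotate bracket_vertices(4))
  also have "bracket (k \<times> n) (m \<times> l) (k \<times> l) = - (bracket k l m * bracket k l n)"
    by (metis bracket_rotate bracket_vertices(3))
  finally show ?thesis by simp
qed

lemma diagonal_point_abs:
  assumes q: "quad k l m n"
  shows "diagonal_vector k l m n \<noteq> 0"
    "diagonal_point (abs_pline k) (abs_pline l) (abs_pline m) (abs_pline n) = abs_ppoint (diagonal_vector k l m n)"
proof -
  note nz = quad_brackets[OF q]
  have c: "k \<times> l \<noteq> 0" "m \<times> n \<noteq> 0" "k \<times> n \<noteq> 0" "m \<times> l \<noteq> 0" using quad_neq_0[OF q] by simp_all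
  have b: "bracket (k \<times> n) (m \<times> l) (k \<times> l) \<noteq> 0" "bracket (k \<times> l) (m \<times> n) (k \<times> n) \<noteq> 0"
    using nz bracket_vertices(3)[of k l n m] bracket_vertices(1)[of k l m n]
    by (auto simp: bracket_perms(1)[where a = "k \<times> l" and b = "k \<times> n" and c = "m \<times> l"])
  have "bracket (diagonal_vector k l m n) (k \<times> n) (k \<times> l) =
      (bracket k l n * bracket k m n) * bracket (m \<times> l) (k \<times> n) (k \<times> l)"
    by (simp add: diagonal_vector_eq bracket_linear)
  also have "\<dots> \<noteq> 0"
    using nz bracket_perms(5)[where a = "k \<times> l" and b = "k \<times> n" and c = "m \<times> l"]
    by (simp add: bracket_vertices)
  finally show d0: "diagonal_vector k l m n \<noteq> 0" using bracket_neq_0_imp(1) by blast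
  have "(k \<times> l) \<times> (m \<times> n) \<noteq> 0" "(k \<times> n) \<times> (m \<times> l) \<noteq> 0" using b bracket_neq_0_imp(4) by blast+
  with d0 c show "diagonal_point (abs_pline k) (abs_pline l) (abs_pline m) (abs_pline n) = abs_ppoint (diagonal_vector k l m n)"
    by (simp add: diagonal_point_def meet_abs join_abs diagonal_vector_def)
qed

text \<open>
  The classical fact that the chord joining the tangency points on two opposite edge-lines passes
  through the intersection of the diagonals.
\<close>

lemma chord_through_diagonal_vector:
  "bracket (pencil k l m n \<alpha> \<beta> *v k) (pencil k l m n \<alpha> \<beta> *v m) (diagonal_vector k l m n) = 0"
proof -
  define P P' S S' where defs: "P = k \<times> l" "P' = m \<times> n" "S = k \<times> n" "S' = m \<times> l"
  note vals = bracket_vertices[where k = k and l = l and m = m and n = n, folded defs]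
  show ?thesis
    unfolding diagonal_vector_eq pencil_mult defs[symmetric]
    by (simp add: bracket_linear vals bracket_perms[where a = P and b = P' and c = S]
        bracket_perms[where a = P and b = P' and c = S'] bracket_perms[where a = P and b = S and c = S']
        bracket_perms[where a = P' and b = S and c = S']
        bracket_perms[where a = k and b = l and c = m] bracket_perms[where a = k and b = l and c = n]
        bracket_perms[where a = k and b = m and c = n] bracket_perms[where a = l and b = m and c = n] algebra_simps)
qed

text \<open>
  The chord of contact on \<open>k\<close> and \<open>m\<close> is the polar of \<open>k \<inter> m\<close>. It meets the edge-line \<open>l\<close> in the
  harmonic conjugate, with respect to \<open>k \<inter> l\<close> and \<open>m \<inter> l\<close>, of the tangency point on \<open>l\<close>. Taking the
  harmonic conjugate changes the sign of one coefficient, hence of one parameter of the pencil.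
\<close>

lemma chord_meets_edge:
  "bracket (pencil k l m n \<alpha> \<beta> *v k) (pencil k l m n \<alpha> \<beta> *v m) (pencil k l m n (- \<alpha>) \<beta> *v l) = 0"
proof -
  define P P' S S' where defs: "P = k \<times> l" "P' = m \<times> n" "S = k \<times> n" "S' = m \<times> l"
  note vals = bracket_vertices[where k = k and l = l and m = m and n = n, folded defs]
  show ?thesis
    unfolding pencil_mult defs[symmetric]
    by (simp add: bracket_linear vals bracket_perms[where a = P and b = P' and c = S]
        bracket_perms[where a = P and b = P' and c = S'] bracket_perms[where a = P and b = S and c = S']
        bracket_perms[where a = P' and b = S and c = S']
        bracket_perms[where a = k and b = l and c = m] bracket_perms[where a = k and b = l and c = n]
        bracket_perms[where a = k and b = m and c = n] bracket_perms[where a = l and b = m and c = n] algebra_simps)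
qed

lemma diagonal_point_swap: "diagonal_point l k n m = diagonal_point k l m n"
  unfolding diagonal_point_def
  by (simp add: meet_commute[of l] meet_commute[of n] join_commute[of "meet m l"])

text \<open>
  Two lines, each given by two points, are intersected with the line \<open>U V\<close>. Eliminating the
  common point \<open>P\<close> on the first line, and \<open>Q\<close> on the second, leaves two combinations of \<open>U\<close> and
  \<open>V\<close>; the last factor compares their coefficient ratios.
\<close>

lemma bracket_cross_lines:
  assumes "r11 = a *\<^sub>R U + b *\<^sub>R P" "r21 = c *\<^sub>R V + d *\<^sub>R P"
    "r12 = e *\<^sub>R U + f *\<^sub>R Q" "r22 = g *\<^sub>R V + h *\<^sub>R Q"
  shows "bracket (r11 \<times> r21) (r12 \<times> r22) (U \<times> V) =
    bracket U V P * bracket U V Q * (b * c * e * h - a * d * f * g)"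
proof -
  have "(r11 \<times> r21) \<bullet> U = - (b * c * bracket U V P)" "(r11 \<times> r21) \<bullet> V = - (a * d * bracket U V P)"
    "(r12 \<times> r22) \<bullet> U = - (f * g * bracket U V Q)" "(r12 \<times> r22) \<bullet> V = - (e * h * bracket U V Q)"
    unfolding assms bracket_def[symmetric]
    using bracket_perms[where a = U and b = V and c = P] bracket_perms[where a = U and b = V and c = Q]
    by (simp_all add: bracket_linear)
  then show ?thesis
    unfolding bracket_def[of "_ \<times> _"] dot_cross by (simp add: algebra_simps)
qed

text \<open>
  \<open>E\<close> is the dual form of a nondegenerate conic inscribed in the quadrilateral, and \<open>a\<close> its chord
  of contact on \<open>k\<close> and \<open>m\<close>.
\<close>

lemma chord_collinear:
  assumes q: "quad k l m n" and det: "det E \<noteq> 0" and E: "E = b *\<^sub>R pencil k l m n t 1"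
  defines "a \<equiv> abs_pline ((E *v k) \<times> (E *v m))"
  shows "lies_on (diagonal_point (abs_pline k) (abs_pline l) (abs_pline m) (abs_pline n)) a"
    "lies_on (tangency_point (inconic k l m n (- t)) (abs_pline l)) a"
    "lies_on (tangency_point (inconic k l m n (- t)) (abs_pline n)) a"
proof -
  let ?F = "pencil k l m n t 1"
  have "cof E *v (k \<times> m) \<noteq> 0"
    using det_neq_0_imp_kernel[of "cof E" "k \<times> m"] det quad_neq_0[OF q] by (auto simp: det_cof)
  then have a0: "(E *v k) \<times> (E *v m) \<noteq> 0" by (simp add: cof_mult_cross)
  have Emult: "E *v x = b *\<^sub>R (?F *v x)" for x
    by (simp add: E scaleR_matrix_vector_assoc)
  have on: "lies_on (abs_ppoint x) a" if "x \<noteq> 0" "bracket (?F *v k) (?F *v m) x = 0" for x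
  proof -
    have "bracket (E *v k) (E *v m) x = 0" using that by (simp add: Emult bracket_linear)
    then show ?thesis using that a0 by (simp add: a_def lies_on_abs bracket_def inner_commute)
  qed
  show "lies_on (diagonal_point (abs_pline k) (abs_pline l) (abs_pline m) (abs_pline n)) a"
    using on diagonal_point_abs[OF q] chord_through_diagonal_vector by simp
  have "tangency_point (inconic k l m n (- t)) (abs_pline l) = abs_ppoint (pencil k l m n (- t) 1 *v l)"
    using tangency_point_inconic[OF quad_swap[OF q], of "- t"] by (simp add: inconic_swap pencil_swap)
  moreover have "pencil k l m n (- t) 1 *v l \<noteq> 0"
    using pencil_mult_edge_neq_0[OF quad_swap[OF q], of "- t" 1] by (simp add: pencil_swap)
  ultimately show "lies_on (tangency_point (inconic k l m n (- t)) (abs_pline l)) a"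
    using on chord_meets_edge by simp
  have "tangency_point (inconic k l m n (- t)) (abs_pline n) = abs_ppoint (pencil k l m n (- t) 1 *v n)"
    using tangency_point_inconic[OF quad_swap[OF quad_opposite[OF q]], of "- t"]
    by (simp add: inconic_swap pencil_swap inconic_opposite pencil_opposite)
  moreover have "pencil k l m n (- t) 1 *v n \<noteq> 0"
    using pencil_mult_edge_neq_0[OF quad_swap[OF quad_opposite[OF q]], of "- t" 1]
    by (simp add: pencil_swap pencil_opposite)
  moreover have "bracket (?F *v k) (?F *v m) (pencil k l m n (- t) 1 *v n) = 0"
    using chord_meets_edge[of m n k l t 1] bracket_swap[of "?F *v k" "?F *v m"]
    by (simp add: pencil_opposite)
  ultimately show "lies_on (tangency_point (inconic k l m n (- t)) (abs_pline n)) a"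
    using on by simp
qed

text \<open>
  Of two neighbouring diagonal points \<open>r\<^sub>1\<^sub>1\<close> and \<open>r\<^sub>2\<^sub>1\<close>, the first is a combination of \<open>k\<^sub>0 \<inter> l\<^sub>1\<close>
  and \<open>k\<^sub>1 \<inter> l\<^sub>0\<close>, the second of \<open>k\<^sub>2 \<inter> l\<^sub>1\<close> and the same point \<open>k\<^sub>1 \<inter> l\<^sub>0\<close>. So
  \<open>bracket_cross_lines\<close> applies with \<open>U\<close>, \<open>V\<close> on \<open>l\<^sub>1\<close>, and after cancelling common brackets its last
  factor is the stated identity.
\<close>

lemma concurrent_diagonal_vectors_iff:
  assumes q: "quad k0 l0 k1 l1" "quad k1 l0 k2 l1" "quad k0 l1 k1 l2" "quad k1 l1 k2 l2"
    and nz: "bracket k0 l1 k2 \<noteq> 0"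
  shows "concurrent
      {join (abs_ppoint (diagonal_vector k0 l0 k1 l1)) (abs_ppoint (diagonal_vector k1 l0 k2 l1)),
       join (abs_ppoint (diagonal_vector k0 l1 k1 l2)) (abs_ppoint (diagonal_vector k1 l1 k2 l2)),
       abs_pline l1} \<longleftrightarrow>
    bracket k0 l0 k1 * bracket k2 l2 k1 * (bracket k0 l2 l1 * bracket k2 l0 l1) =
    bracket k0 l2 k1 * bracket k2 l0 k1 * (bracket k0 l0 l1 * bracket k2 l2 l1)"
proof -
  note perms = bracket_perms[where a = k0 and b = k1 and c = l0] bracket_perms[where a = k1 and b = l0 and c = l1]
    bracket_perms[where a = k1 and b = k2 and c = l0] bracket_perms[where a = k2 and b = l0 and c = l1]
    bracket_perms[where a = k1 and b = l1 and c = l2] bracket_perms[where a = k0 and b = k1 and c = l1]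
    bracket_perms[where a = k1 and b = k2 and c = l1] bracket_perms[where a = k2 and b = l1 and c = l2]
    bracket_perms[where a = k1 and b = k2 and c = l2] bracket_perms[where a = k0 and b = l1 and c = l2]
    bracket_perms[where a = k0 and b = k1 and c = l2]
  define U V P Q where defs: "U = k0 \<times> l1" "V = k2 \<times> l1" "P = k1 \<times> l0" "Q = k1 \<times> l2"
  define a b c d e f g h where coeffs:
    "a = bracket k0 k1 l0 * bracket k1 l0 l1" "b = bracket k0 l0 l1 * bracket k0 k1 l1"
    "c = bracket k1 k2 l0 * bracket k1 l0 l1" "d = bracket k1 k2 l1 * bracket k2 l0 l1"
    "e = bracket k0 k1 l2 * bracket k1 l1 l2" "f = bracket k0 k1 l1 * bracket k0 l1 l2"
    "g = bracket k1 l1 l2 * bracket k1 k2 l2" "h = bracket k1 k2 l1 * bracket k2 l1 l2"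
  define R11 R21 R12 R22 where R: "R11 = diagonal_vector k0 l0 k1 l1" "R21 = diagonal_vector k1 l0 k2 l1"
    "R12 = diagonal_vector k0 l1 k1 l2" "R22 = diagonal_vector k1 l1 k2 l2"
  have R11: "R11 = a *\<^sub>R U + b *\<^sub>R P" and R22: "R22 = g *\<^sub>R V + h *\<^sub>R Q"
    by (simp_all add: R diagonal_vector_eq defs coeffs perms)
  have R21: "R21 = c *\<^sub>R V + d *\<^sub>R P" and R12: "R12 = e *\<^sub>R U + f *\<^sub>R Q"
    by (simp_all add: R diagonal_vector_eq' defs coeffs perms)
  have nz': "bracket k0 k1 l0 \<noteq> 0" "bracket k1 l0 l1 \<noteq> 0" "bracket k0 l0 l1 \<noteq> 0" "bracket k0 k1 l1 \<noteq> 0"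
    "bracket k1 k2 l0 \<noteq> 0" "bracket k1 k2 l1 \<noteq> 0" "bracket k2 l0 l1 \<noteq> 0" "bracket k0 k1 l2 \<noteq> 0"
    "bracket k1 l1 l2 \<noteq> 0" "bracket k0 l1 l2 \<noteq> 0" "bracket k1 k2 l2 \<noteq> 0" "bracket k2 l1 l2 \<noteq> 0"
    by (rule quad_brackets[OF q(1)] quad_brackets[OF q(2)] quad_brackets[OF q(3)] quad_brackets[OF q(4)])+
  have UV: "U \<times> V = (- bracket k0 l1 k2) *\<^sub>R l1"
    by (simp add: defs cross_cross_bracket)
  have "bracket U V P = - bracket k0 l1 k2 * bracket k1 l0 l1" "bracket U V Q = bracket k0 l1 k2 * bracket k1 l1 l2"
    by (simp_all add: defs bracket_crosses perms)
  then have UVPQ: "bracket U V P \<noteq> 0" "bracket U V Q \<noteq> 0"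
    using nz nz' by simp_all
  have "bracket R11 R21 U = - (b * c * bracket U V P)" "bracket R12 R22 U = - (f * g * bracket U V Q)"
    by (simp_all add: R11 R21 R12 R22 bracket_linear bracket_perms[where a = U and b = V and c = P]
        bracket_perms[where a = U and b = V and c = Q])
  then have "bracket R11 R21 U \<noteq> 0" "bracket R12 R22 U \<noteq> 0"
    using UVPQ nz' by (simp_all add: coeffs)
  then have c: "R11 \<times> R21 \<noteq> 0" "R12 \<times> R22 \<noteq> 0"
    using bracket_neq_0_imp(4) by blast+
  have "bracket (R11 \<times> R21) (R12 \<times> R22) l1 = 0 \<longleftrightarrow> bracket (R11 \<times> R21) (R12 \<times> R22) (U \<times> V) = 0"
    using nz by (simp add: UV bracket_linear)
  also have "\<dots> \<longleftrightarrow> b * c * e * h - a * d * f * g = 0"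
    using UVPQ by (simp add: bracket_cross_lines[OF R11 R21 R12 R22])
  also have "b * c * e * h - a * d * f * g =
      (bracket k0 k1 l1 * bracket k1 l0 l1 * bracket k1 l1 l2 * bracket k1 k2 l1) *
      (bracket k0 k1 l2 * bracket k1 k2 l0 * (bracket k0 l0 l1 * bracket k2 l1 l2) -
       bracket k0 k1 l0 * bracket k1 k2 l2 * (bracket k0 l1 l2 * bracket k2 l0 l1))"
    unfolding coeffs by (simp only: right_diff_distrib mult.assoc mult.left_commute mult.commute)
  finally have "bracket (R11 \<times> R21) (R12 \<times> R22) l1 = 0 \<longleftrightarrow>
      bracket k0 k1 l0 * bracket k1 k2 l2 * (bracket k0 l1 l2 * bracket k2 l0 l1) =
      bracket k0 k1 l2 * bracket k1 k2 l0 * (bracket k0 l0 l1 * bracket k2 l1 l2)"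
    using nz' by auto
  then show ?thesis
    using c quad_neq_0[OF q(1)] concurrent_iff_bracket[OF c, of l1]
    by (simp add: join_abs perms flip: R)
qed

unbundle no cross3_syntax

section \<open>Grids\<close>

text \<open>
  All twenty brackets of the six lines are nonzero; the two families play symmetric roles, so
  every fact about the lines \<open>K\<close> has a counterpart for the lines \<open>L\<close>.
\<close>

definition generic_grid :: "(nat \<Rightarrow> real ^ 3) \<Rightarrow> (nat \<Rightarrow> real ^ 3) \<Rightarrow> bool" where
  "generic_grid K L \<longleftrightarrow>
     bracket (K 0) (K 1) (K 2) \<noteq> 0 \<and> bracket (L 0) (L 1) (L 2) \<noteq> 0 \<and>
     (\<forall>i\<in>{0, 1, 2}. \<forall>i'\<in>{0, 1, 2}. \<forall>j\<in>{0, 1, 2}. i \<noteq> i' \<longrightarrow>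
       bracket (K i) (K i') (L j) \<noteq> 0 \<and> bracket (L i) (L i') (K j) \<noteq> 0)"

lemma generic_grid_swap: "generic_grid K L \<Longrightarrow> generic_grid L K"
  by (auto simp: generic_grid_def)

lemma generic_imp_generic_grid:
  assumes gen: "generic [abs_pline (K 0), abs_pline (K 1), abs_pline (K 2),
      abs_pline (L 0), abs_pline (L 1), abs_pline (L 2)]"
    and nz: "\<And>i. K i \<noteq> 0" "\<And>j. L j \<noteq> 0"
  shows "generic_grid K L"
proof -
  let ?S = "{K 0, K 1, K 2, L 0, L 1, L 2}"
  have b: "bracket a b c \<noteq> 0"
    if "a \<in> ?S" "b \<in> ?S" "c \<in> ?S" "distinct [abs_pline a, abs_pline b, abs_pline c]" for a b c
  proof -
    have "x \<noteq> 0" if "x \<in> ?S" for x using that nz by auto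
    then have "a \<noteq> 0" "b \<noteq> 0" "c \<noteq> 0" using that(1-3) by blast+
    moreover have "\<not> concurrent {abs_pline a, abs_pline b, abs_pline c}"
    proof -
      have "{abs_pline a, abs_pline b, abs_pline c} \<subseteq> set [abs_pline (K 0), abs_pline (K 1), abs_pline (K 2),
          abs_pline (L 0), abs_pline (L 1), abs_pline (L 2)]" (is "_ \<subseteq> ?lines")
      proof -
        have "abs_pline x \<in> ?lines" if "x \<in> ?S" for x using that by auto
        then show ?thesis using that(1-3) by blast
      qed
      then show ?thesis using gen that(4) unfolding generic_def by blast
    qed
    ultimately show ?thesis using concurrent_iff_bracket by blast
  qed
  have d: "distinct [abs_pline (K 0), abs_pline (K 1), abs_pline (K 2),
      abs_pline (L 0), abs_pline (L 1), abs_pline (L 2)]"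
    using gen by (simp add: generic_def)
  show ?thesis
    unfolding generic_grid_def
  proof (intro conjI ballI impI)
    show "bracket (K 0) (K 1) (K 2) \<noteq> 0" "bracket (L 0) (L 1) (L 2) \<noteq> 0"
      using b[of "K 0" "K 1" "K 2"] b[of "L 0" "L 1" "L 2"] d by simp_all
  next
    fix i i' j :: nat
    assume "i \<in> {0, 1, 2}" "i' \<in> {0, 1, 2}" "j \<in> {0, 1, 2}" "i \<noteq> i'"
    then have "distinct [abs_pline (K i), abs_pline (K i'), abs_pline (L j)]"
      "distinct [abs_pline (L i), abs_pline (L i'), abs_pline (K j)]"
      "K i \<in> ?S" "K i' \<in> ?S" "K j \<in> ?S" "L i \<in> ?S" "L i' \<in> ?S" "L j \<in> ?S"
      using d by auto
    note mem = this
    show "bracket (K i) (K i') (L j) \<noteq> 0" by (rule b; fact mem)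
    show "bracket (L i) (L i') (K j) \<noteq> 0" by (rule b; fact mem)
  qed
qed

lemma generic_grid_quad:
  assumes "generic_grid K L" "i \<in> {0, 1, 2}" "i' \<in> {0, 1, 2}" "j \<in> {0, 1, 2}" "j' \<in> {0, 1, 2}"
    "i \<noteq> i'" "j \<noteq> j'"
  shows "quad (K i) (L j) (K i') (L j')"
proof -
  have "bracket (K i) (K i') (L j) \<noteq> 0" "bracket (K i) (K i') (L j') \<noteq> 0"
    "bracket (L j) (L j') (K i) \<noteq> 0" "bracket (L j) (L j') (K i') \<noteq> 0"
    using assms unfolding generic_grid_def by blast+
  then show ?thesis
    unfolding quad_def using bracket_neq_0_permute by metis
qed

lemma generic_grid_cells:
  assumes "generic_grid K L" "i \<in> {1, 2}" "j \<in> {1, 2}"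
  shows "quad (K (i - 1)) (L (j - 1)) (K i) (L j)"
  using assms by (intro generic_grid_quad) auto

definition grid_conic ::
    "(nat \<Rightarrow> real ^ 3) \<Rightarrow> (nat \<Rightarrow> real ^ 3) \<Rightarrow> nat \<Rightarrow> nat \<Rightarrow> real \<Rightarrow> conic" where
  "grid_conic K L i j t = inconic (K (i - 1)) (L (j - 1)) (K i) (L j) t"

lemma grid_conic_swap: "grid_conic L K j i t = grid_conic K L i j t"
  by (simp add: grid_conic_def inconic_swap)

definition grid_conics ::
    "(nat \<Rightarrow> real ^ 3) \<Rightarrow> (nat \<Rightarrow> real ^ 3) \<Rightarrow> (nat \<times> nat \<Rightarrow> real) \<Rightarrow> nat \<times> nat \<Rightarrow> conic" where
  "grid_conics K L t = (\<lambda>(i, j) \<in> {1, 2} \<times> {1, 2}. grid_conic K L i j (t (i, j)))"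

lemma grid_conics_apply:
  "i \<in> {1, 2} \<Longrightarrow> j \<in> {1, 2} \<Longrightarrow> grid_conics K L t (i, j) = grid_conic K L i j (t (i, j))"
  by (auto simp: grid_conics_def)

definition touching_ratios ::
    "(nat \<Rightarrow> real ^ 3) \<Rightarrow> (nat \<Rightarrow> real ^ 3) \<Rightarrow> (nat \<times> nat \<Rightarrow> real) \<Rightarrow> bool" where
  "touching_ratios K L t \<longleftrightarrow>
     (\<forall>j\<in>{1, 2}. t (1, j) * t (2, j) * (bracket (K 0) (L (j - 1)) (K 1) * bracket (K 2) (L j) (K 1)) =
        bracket (K 0) (L j) (K 1) * bracket (K 2) (L (j - 1)) (K 1)) \<and>
     (\<forall>i\<in>{1, 2}. t (i, 1) * t (i, 2) * (bracket (L 0) (K (i - 1)) (L 1) * bracket (L 2) (K i) (L 1)) =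
        bracket (L 0) (K i) (L 1) * bracket (L 2) (K (i - 1)) (L 1))"

lemma grid_touching_iff:
  assumes g: "generic_grid K L" and j: "j \<in> {1, 2}"
  shows "tangency_point (grid_conic K L 1 j s) (abs_pline (K 1)) =
      tangency_point (grid_conic K L 2 j t) (abs_pline (K 1)) \<longleftrightarrow>
    s * t * (bracket (K 0) (L (j - 1)) (K 1) * bracket (K 2) (L j) (K 1)) =
      bracket (K 0) (L j) (K 1) * bracket (K 2) (L (j - 1)) (K 1)"
  using touching_iff[OF generic_grid_cells[OF g _ j, of 1], of "K 2" s t]
    generic_grid_cells[OF g _ j, of 2]
  by (simp add: grid_conic_def)

lemma touching_ratios_iff:
  assumes g: "generic_grid K L"
  shows "touching_ratios K L t \<longleftrightarrow>
    (\<forall>j\<in>{1, 2}. tangency_point (grid_conic K L 1 j (t (1, j))) (abs_pline (K 1)) =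
       tangency_point (grid_conic K L 2 j (t (2, j))) (abs_pline (K 1))) \<and>
    (\<forall>i\<in>{1, 2}. tangency_point (grid_conic K L i 1 (t (i, 1))) (abs_pline (L 1)) =
       tangency_point (grid_conic K L i 2 (t (i, 2))) (abs_pline (L 1)))"
  unfolding touching_ratios_def grid_conic_swap[of K L, symmetric]
  using grid_touching_iff[OF g] grid_touching_iff[OF generic_grid_swap[OF g]]
  by (simp add: grid_conic_swap[of K L])

lemma touching_instance_iff:
  assumes g: "generic_grid K L"
  shows "touching_instance (\<lambda>i. abs_pline (K i)) (\<lambda>j. abs_pline (L j)) C \<longleftrightarrow>
    (\<exists>t. (\<forall>i\<in>{1, 2}. \<forall>j\<in>{1, 2}. t (i, j) \<noteq> 0) \<and> touching_ratios K L t \<and> C = grid_conics K L t)"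
    (is "?lhs \<longleftrightarrow> ?rhs")
proof
  assume C: ?lhs
  then have "\<exists>s. s \<noteq> 0 \<and> C (i, j) = grid_conic K L i j s" if "i \<in> {1, 2}" "j \<in> {1, 2}" for i j
    using that inscribed_iff_inconic[OF generic_grid_cells[OF g that]]
    unfolding touching_instance_def grid_conic_def by blast
  then have "\<forall>x. \<exists>s. x \<in> {1, 2} \<times> {1, 2} \<longrightarrow> s \<noteq> 0 \<and> C x = grid_conic K L (fst x) (snd x) s"
    by (metis mem_Sigma_iff prod.collapse)
  then obtain t where t: "x \<in> {1, 2} \<times> {1, 2} \<Longrightarrow> t x \<noteq> 0 \<and> C x = grid_conic K L (fst x) (snd x) (t x)" for x
    by metis
  have Ceq: "C (i, j) = grid_conic K L i j (t (i, j))" if "i \<in> {1, 2}" "j \<in> {1, 2}" for i j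
    using t[of "(i, j)"] that by auto
  have "C = grid_conics K L t"
  proof (rule extensionalityI)
    show "C \<in> extensional ({1, 2} \<times> {1, 2})" using C by (simp add: touching_instance_def)
    show "grid_conics K L t \<in> extensional ({1, 2} \<times> {1, 2})" by (simp add: grid_conics_def)
  qed (use Ceq in \<open>auto simp: grid_conics_apply\<close>)
  moreover have "touching_ratios K L t"
    unfolding touching_ratios_iff[OF g] using C Ceq unfolding touching_instance_def by simp
  ultimately show ?rhs using t by auto
next
  assume ?rhs
  then obtain t where t: "\<And>i j. i \<in> {1, 2} \<Longrightarrow> j \<in> {1, 2} \<Longrightarrow> t (i, j) \<noteq> 0"
    "touching_ratios K L t" "C = grid_conics K L t"
    by blast
  show ?lhs
    unfolding touching_instance_def
  proof (intro conjI)
    show "C \<in> extensional ({1, 2} \<times> {1, 2})" by (simp add: t grid_conics_def)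
    show "\<forall>i\<in>{1, 2}. \<forall>j\<in>{1, 2}. inscribed (abs_pline (K (i - 1))) (abs_pline (L (j - 1)))
        (abs_pline (K i)) (abs_pline (L j)) (C (i, j))"
      using inscribed_iff_inconic[OF generic_grid_cells[OF g]] t(1)
      unfolding t(3) by (metis grid_conic_def grid_conics_apply)
  qed (use t(2) in \<open>auto simp: t(3) grid_conics_apply touching_ratios_iff[OF g]\<close>)
qed

section \<open>Six lines tangent to a conic\<close>

text \<open>
  The condition that six lines touch a common conic, as the equality of two cross ratios: one
  formed by the intersections of \<open>k\<^sub>0, l\<^sub>0, k\<^sub>2, l\<^sub>2\<close> with \<open>k\<^sub>1\<close>, the other by those with \<open>l\<^sub>1\<close>.
\<close>

definition six_tangent :: "(nat \<Rightarrow> real ^ 3) \<Rightarrow> (nat \<Rightarrow> real ^ 3) \<Rightarrow> bool" where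
  "six_tangent K L \<longleftrightarrow>
     bracket (K 0) (L 0) (K 1) * bracket (K 2) (L 2) (K 1) * (bracket (K 0) (L 2) (L 1) * bracket (K 2) (L 0) (L 1)) =
     bracket (K 0) (L 2) (K 1) * bracket (K 2) (L 0) (K 1) * (bracket (K 0) (L 0) (L 1) * bracket (K 2) (L 2) (L 1))"

lemma six_tangent_swap: "six_tangent L K \<longleftrightarrow> six_tangent K L"
  unfolding six_tangent_def
  by (auto simp: bracket_swap[of "L _" "K _"] ac_simps)

definition enveloped :: "(nat \<Rightarrow> real ^ 3) \<Rightarrow> (nat \<Rightarrow> real ^ 3) \<Rightarrow> real ^ 3 ^ 3 \<Rightarrow> bool" where
  "enveloped K L E \<longleftrightarrow> transpose E = E \<and> det E \<noteq> 0 \<and>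
     (\<forall>i\<in>{0, 1, 2}. K i \<bullet> (E *v K i) = 0 \<and> L i \<bullet> (E *v L i) = 0)"

lemma ex_tangent_conic_iff_enveloped:
  assumes "\<And>i. K i \<noteq> 0" "\<And>j. L j \<noteq> 0"
  shows "(\<exists>C. nondegenerate C \<and> (\<forall>a \<in> {abs_pline (K 0), abs_pline (K 1), abs_pline (K 2),
      abs_pline (L 0), abs_pline (L 1), abs_pline (L 2)}. \<exists>p. tangent_at C a p)) \<longleftrightarrow>
    (\<exists>E. enveloped K L E)"
proof
  assume "\<exists>C. nondegenerate C \<and> (\<forall>a \<in> {abs_pline (K 0), abs_pline (K 1), abs_pline (K 2),
      abs_pline (L 0), abs_pline (L 1), abs_pline (L 2)}. \<exists>p. tangent_at C a p)"
  then obtain C where C: "nondegenerate C" "\<forall>a \<in> {abs_pline (K 0), abs_pline (K 1), abs_pline (K 2),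
      abs_pline (L 0), abs_pline (L 1), abs_pline (L 2)}. \<exists>p. tangent_at C a p"
    by blast
  obtain E where E: "transpose E = E" "det E \<noteq> 0" "C = conic_of_dual E"
    using C(1) by (rule nondegenerate_imp_conic_of_dual)
  have "a \<bullet> (E *v a) = 0" if "a \<in> {K 0, K 1, K 2, L 0, L 1, L 2}" for a
    using that assms C(2) E tangent_at_imp_isotropic[OF E(1,2), of a] by blast
  then have "enveloped K L E" using E by (simp add: enveloped_def)
  then show "\<exists>E. enveloped K L E" ..
next
  assume "\<exists>E. enveloped K L E"
  then obtain E where E: "transpose E = E" "det E \<noteq> 0"
    "\<And>a. a \<in> {K 0, K 1, K 2, L 0, L 1, L 2} \<Longrightarrow> a \<bullet> (E *v a) = 0"
    unfolding enveloped_def by blast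
  have "tangent_at (conic_of_dual E) (abs_pline a) (abs_ppoint (E *v a))"
    if "a \<in> {K 0, K 1, K 2, L 0, L 1, L 2}" for a
  proof -
    have "a \<noteq> 0" using that assms by auto
    then have "E *v a \<noteq> 0" using det_neq_0_imp_kernel[OF E(2)] by blast
    then show ?thesis using E(1) E(3)[OF that] by (simp add: tangent_at_conic_of_dual_iff)
  qed
  moreover have "cof E \<noteq> 0" using E(2) det_cof[of E] by (auto simp: det_3)
  then have "nondegenerate (conic_of_dual E)" using E by (simp add: nondegenerate_conic_of_dual)
  ultimately show "\<exists>C. nondegenerate C \<and> (\<forall>a \<in> {abs_pline (K 0), abs_pline (K 1), abs_pline (K 2),
      abs_pline (L 0), abs_pline (L 1), abs_pline (L 2)}. \<exists>p. tangent_at C a p)"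
    by blast
qed

text \<open>
  A dual form tangent to \<open>k\<^sub>0, l\<^sub>0, k\<^sub>2, l\<^sub>2\<close> is \<open>\<alpha> E\<^sub>1 + \<beta> E\<^sub>2\<close>, and its values on \<open>k\<^sub>1\<close> and \<open>l\<^sub>1\<close> are
  \<open>2 (\<alpha> x + \<beta> y)\<close> with \<open>x, y\<close> products of two brackets. The two equations are compatible iff
  \<open>six_tangent\<close> holds.
\<close>

lemma ex_enveloped_iff_six_tangent:
  assumes g: "generic_grid K L"
  shows "(\<exists>E. enveloped K L E) \<longleftrightarrow> six_tangent K L"
proof -
  have q: "quad (K 0) (L 0) (K 2) (L 2)" using g by (intro generic_grid_quad) auto
  define x where "x a = bracket (K 0) (L 0) a * bracket (K 2) (L 2) a" for a
  define y where "y a = bracket (K 0) (L 2) a * bracket (K 2) (L 0) a" for a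
  have form: "a \<bullet> (pencil (K 0) (L 0) (K 2) (L 2) \<alpha> \<beta> *v a) = 2 * (\<alpha> * x a + \<beta> * y a)" for \<alpha> \<beta> a
    by (simp add: pencil_form x_def y_def algebra_simps)
  have M: "six_tangent K L \<longleftrightarrow> x (K 1) * y (L 1) = y (K 1) * x (L 1)"
    by (simp add: six_tangent_def x_def y_def)
  have "bracket (K 0) (L 0) (K 1) \<noteq> 0" "bracket (K 2) (L 2) (K 1) \<noteq> 0"
    "bracket (K 0) (L 2) (K 1) \<noteq> 0" "bracket (K 2) (L 0) (K 1) \<noteq> 0"
    using quad_brackets[OF generic_grid_quad[OF g, of 0 1 0 2]] quad_brackets[OF generic_grid_quad[OF g, of 2 1 0 2]]
    by simp_all
  then have xy: "x (K 1) \<noteq> 0" "y (K 1) \<noteq> 0" by (simp_all add: x_def y_def)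
  show ?thesis
  proof
    assume "\<exists>E. enveloped K L E"
    then obtain E where E: "enveloped K L E" ..
    then obtain \<alpha> \<beta> where ab: "E = pencil (K 0) (L 0) (K 2) (L 2) \<alpha> \<beta>"
      unfolding enveloped_def by (auto intro: isotropic_imp_pencil[OF q, of E])
    with E have "\<alpha> \<noteq> 0" by (auto simp: enveloped_def det_pencil_neq_0_iff[OF q])
    moreover have "\<alpha> * x (K 1) + \<beta> * y (K 1) = 0" "\<alpha> * x (L 1) + \<beta> * y (L 1) = 0"
      using E by (simp_all add: enveloped_def ab form)
    then have "\<alpha> * (x (K 1) * y (L 1) - y (K 1) * x (L 1)) = 0" by algebra
    ultimately show "six_tangent K L" unfolding M by simp
  next
    assume six: "six_tangent K L"
    \<comment> \<open>the parameters that make the form vanish at \<open>k\<^sub>1\<close>; the identity then gives \<open>l\<^sub>1\<close>\<close>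
    let ?E = "pencil (K 0) (L 0) (K 2) (L 2) (y (K 1)) (- x (K 1))"
    have "bracket (K 0) (K 2) (K 1) \<noteq> 0" "bracket (L 0) (L 2) (K 1) \<noteq> 0"
      using g bracket_neq_0_permute(1)[of "K 0" "K 1" "K 2"] by (auto simp: generic_grid_def)
    \<comment> \<open>the double line of the outer quadrilateral is not tangent to \<open>k\<^sub>1\<close>, by genericity\<close>
    moreover have deg: "pencil (K 0) (L 0) (K 2) (L 2) (- 1) 1 = (- 1) *\<^sub>R point_pair (cross3 (K 0) (K 2)) (cross3 (L 0) (L 2))"
      by (simp add: pencil_degenerate)
    have "K 1 \<bullet> (pencil (K 0) (L 0) (K 2) (L 2) (- 1) 1 *v K 1) =
        - 2 * (bracket (K 0) (K 2) (K 1) * bracket (L 0) (L 2) (K 1))"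
      unfolding deg scaleR_matrix_vector_assoc[symmetric] point_pair_mult
      by (simp add: bracket_def inner_diff_right inner_minus_right inner_commute)
    ultimately have "x (K 1) \<noteq> y (K 1)" unfolding form by auto
    then have "det ?E \<noteq> 0" using xy by (simp add: det_pencil_neq_0_iff[OF q])
    moreover have "K 1 \<bullet> (?E *v K 1) = 0" "L 1 \<bullet> (?E *v L 1) = 0"
      using six unfolding M form by (simp_all add: algebra_simps)
    ultimately have "enveloped K L ?E"
      by (simp add: enveloped_def transpose_pencil pencil_isotropic)
    then show "\<exists>E. enveloped K L E" ..
  qed
qed

section \<open>Solving the touching equations\<close>

text \<open>
  A \<open>2 \<times> 2\<close> array with prescribed column products \<open>c\<close> and row products \<open>d\<close>: the chosen entry
  determines the other one in its row and the other one in its column, and either of these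
  determines the last entry, consistently by the assumption on the products.
\<close>

lemma ratios_exist:
  fixes c d :: "nat \<Rightarrow> real"
  assumes nz: "c 1 \<noteq> 0" "c 2 \<noteq> 0" "d 1 \<noteq> 0" "d 2 \<noteq> 0" "s \<noteq> 0"
    and cd: "c 1 * c 2 = d 1 * d 2" and ij: "i \<in> {1, 2}" "j \<in> {1, 2}"
  obtains t :: "nat \<times> nat \<Rightarrow> real" where "t (i, j) = s" "\<forall>i\<in>{1, 2}. \<forall>j\<in>{1, 2}. t (i, j) \<noteq> 0"
    "\<forall>j\<in>{1, 2}. t (1, j) * t (2, j) = c j" "\<forall>i\<in>{1, 2}. t (i, 1) * t (i, 2) = d i"
proof -
  define t where "t = (\<lambda>(a, b). if a = i then (if b = j then s else d i / s)
      else if b = j then c j / s else s * c (3 - j) / d i)"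
  have "t (i, j) = s" by (simp add: t_def)
  moreover have "\<forall>i\<in>{1, 2}. \<forall>j\<in>{1, 2}. t (i, j) \<noteq> 0"
    using nz ij by (auto simp: t_def)
  moreover have "\<forall>j\<in>{1, 2}. t (1, j) * t (2, j) = c j"
    using nz ij cd by (auto simp: t_def field_simps)
  moreover have "\<forall>i\<in>{1, 2}. t (i, 1) * t (i, 2) = d i"
    using nz ij cd by (auto simp: t_def field_simps)
  ultimately show thesis by (rule that)
qed

lemma ratios_unique:
  fixes t t' :: "nat \<times> nat \<Rightarrow> real"
  assumes nz: "\<forall>i\<in>{1, 2}. \<forall>j\<in>{1, 2}. t (i, j) \<noteq> 0"
    and col: "\<forall>j\<in>{1, 2}. t (1, j) * t (2, j) = t' (1, j) * t' (2, j)"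
    and row: "\<forall>i\<in>{1, 2}. t (i, 1) * t (i, 2) = t' (i, 1) * t' (i, 2)"
    and ij: "i \<in> {1, 2}" "j \<in> {1, 2}" "t (i, j) = t' (i, j)"
  shows "\<forall>i\<in>{1, 2}. \<forall>j\<in>{1, 2}. t (i, j) = t' (i, j)"
proof -
  have "t (1, 1) \<noteq> 0" "t (1, 2) \<noteq> 0" "t (2, 1) \<noteq> 0" "t (2, 2) \<noteq> 0"
    using nz by simp_all
  moreover have "t (1, 1) * t (2, 1) = t' (1, 1) * t' (2, 1)" "t (1, 2) * t (2, 2) = t' (1, 2) * t' (2, 2)"
    "t (1, 1) * t (1, 2) = t' (1, 1) * t' (1, 2)" "t (2, 1) * t (2, 2) = t' (2, 1) * t' (2, 2)"
    using col row by simp_all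
  ultimately have "t (1, 1) = t' (1, 1) \<and> t (1, 2) = t' (1, 2) \<and> t (2, 1) = t' (2, 1) \<and> t (2, 2) = t' (2, 2)"
    using ij by (elim insertE emptyE) (metis mult.commute mult_left_cancel)+
  then show ?thesis by simp
qed

text \<open>
  The value that \<open>touching_iff\<close> prescribes for the product of the two parameters in column
  \<open>j\<close>; with \<open>K\<close> and \<open>L\<close> exchanged it is the value for the rows.
\<close>

definition column_product :: "(nat \<Rightarrow> real ^ 3) \<Rightarrow> (nat \<Rightarrow> real ^ 3) \<Rightarrow> nat \<Rightarrow> real" where
  "column_product K L j = (bracket (K 0) (L j) (K 1) * bracket (K 2) (L (j - 1)) (K 1)) /
     (bracket (K 0) (L (j - 1)) (K 1) * bracket (K 2) (L j) (K 1))"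

lemma generic_grid_bracket:
  assumes "generic_grid K L" "i \<in> {0, 1, 2}" "j \<in> {0, 1, 2}" "i' \<in> {0, 1, 2}" "i \<noteq> i'"
  shows "bracket (K i) (L j) (K i') \<noteq> 0" "bracket (L i) (K j) (L i') \<noteq> 0"
  using assms bracket_neq_0_permute(1) unfolding generic_grid_def by metis+

lemma column_product_neq_0:
  "generic_grid K L \<Longrightarrow> j \<in> {1, 2} \<Longrightarrow> column_product K L j \<noteq> 0"
  using generic_grid_bracket(1)[of K L] by (auto simp: column_product_def)

lemma touching_ratios_iff_products:
  assumes g: "generic_grid K L"
  shows "touching_ratios K L t \<longleftrightarrow>
    (\<forall>j\<in>{1, 2}. t (1, j) * t (2, j) = column_product K L j) \<and>
    (\<forall>i\<in>{1, 2}. t (i, 1) * t (i, 2) = column_product L K i)"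
proof -
  have "bracket (K 0) (L (j - 1)) (K 1) * bracket (K 2) (L j) (K 1) \<noteq> 0"
    "bracket (L 0) (K (j - 1)) (L 1) * bracket (L 2) (K j) (L 1) \<noteq> 0" if "j \<in> {1, 2}" for j
    using that generic_grid_bracket[OF g] by auto
  then show ?thesis
    unfolding touching_ratios_def column_product_def
    by (intro conj_cong ball_cong refl) (simp_all only: eq_divide_eq if_True not_False_eq_True)
qed

text \<open>
  The brackets of \<open>k\<^sub>0, k\<^sub>1, l\<^sub>1\<close> and of \<open>k\<^sub>1, k\<^sub>2, l\<^sub>1\<close> cancel within the product of the
  columns, and similarly for the rows.
\<close>

lemma column_products_eq_iff:
  assumes g: "generic_grid K L"
  shows "column_product K L 1 * column_product K L 2 = column_product L K 1 * column_product L K 2 \<longleftrightarrow>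
    six_tangent K L"
proof -
  note nz = generic_grid_bracket[OF g]
  have "column_product K L 1 * column_product K L 2 =
      (bracket (K 0) (L 2) (K 1) * bracket (K 2) (L 0) (K 1)) / (bracket (K 0) (L 0) (K 1) * bracket (K 2) (L 2) (K 1))"
    using nz(1)[of 0 1 1] nz(1)[of 2 1 1] by (simp add: column_product_def)
  moreover have "column_product L K 1 * column_product L K 2 =
      (bracket (L 0) (K 2) (L 1) * bracket (L 2) (K 0) (L 1)) / (bracket (L 0) (K 0) (L 1) * bracket (L 2) (K 2) (L 1))"
    using nz(2)[of 0 1 1] nz(2)[of 2 1 1] by (simp add: column_product_def)
  ultimately show ?thesis
    using nz(1)[of 0 0 1] nz(1)[of 2 2 1] nz(2)[of 0 0 1] nz(2)[of 2 2 1]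
    unfolding six_tangent_def bracket_swap[of "K _" "L _" "L 1"]
    by (auto simp: frac_eq_eq ac_simps)
qed

lemma touching_instance_imp_six_tangent:
  assumes g: "generic_grid K L"
    and "touching_instance (\<lambda>i. abs_pline (K i)) (\<lambda>j. abs_pline (L j)) C"
  shows "six_tangent K L"
proof -
  obtain t where "touching_ratios K L t" using assms by (auto simp: touching_instance_iff)
  then have "t (1, 1) * t (2, 1) = column_product K L 1" "t (1, 2) * t (2, 2) = column_product K L 2"
    "t (1, 1) * t (1, 2) = column_product L K 1" "t (2, 1) * t (2, 2) = column_product L K 2"
    by (simp_all add: touching_ratios_iff_products[OF g])
  then have "column_product K L 1 * column_product K L 2 = column_product L K 1 * column_product L K 2"
    by (metis mult.assoc mult.left_commute)
  then show ?thesis using column_products_eq_iff[OF g] by blast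
qed

text \<open>
  One entry of the array of parameters determines the whole instance, and the tangency point
  determines that entry.
\<close>

lemma ex1_touching_instance:
  assumes g: "generic_grid K L" and six: "six_tangent K L"
    and ij: "i \<in> {1, 2}" "j \<in> {1, 2}" and s: "s \<noteq> 0"
    and T: "\<forall>t. tangency_point (grid_conic K L i j t) a = p \<longleftrightarrow> t = s"
  shows "\<exists>!C. touching_instance (\<lambda>i. abs_pline (K i)) (\<lambda>j. abs_pline (L j)) C \<and> tangency_point (C (i, j)) a = p"
proof (rule ex_ex1I)
  obtain t where t: "t (i, j) = s" "\<forall>i\<in>{1, 2}. \<forall>j\<in>{1, 2}. t (i, j) \<noteq> 0"
    "\<forall>j\<in>{1, 2}. t (1, j) * t (2, j) = column_product K L j"
    "\<forall>i\<in>{1, 2}. t (i, 1) * t (i, 2) = column_product L K i"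
  proof -
    have "column_product K L 1 \<noteq> 0" "column_product K L 2 \<noteq> 0"
      "column_product L K 1 \<noteq> 0" "column_product L K 2 \<noteq> 0"
      using column_product_neq_0[OF g] column_product_neq_0[OF generic_grid_swap[OF g]] by simp_all
    moreover have "column_product K L 1 * column_product K L 2 = column_product L K 1 * column_product L K 2"
      using six column_products_eq_iff[OF g] by blast
    ultimately show thesis
      using ratios_exist[of "column_product K L" "column_product L K" s i j] ij s that by metis
  qed
  then have "touching_instance (\<lambda>i. abs_pline (K i)) (\<lambda>j. abs_pline (L j)) (grid_conics K L t)"
    unfolding touching_instance_iff[OF g] touching_ratios_iff_products[OF g] by blast
  moreover have "tangency_point (grid_conics K L t (i, j)) a = p"
    using T t(1) ij by (simp add: grid_conics_apply)
  ultimately show "\<exists>C. touching_instance (\<lambda>i. abs_pline (K i)) (\<lambda>j. abs_pline (L j)) C \<and> tangency_point (C (i, j)) a = p"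
    by blast
next
  fix C C'
  assume "touching_instance (\<lambda>i. abs_pline (K i)) (\<lambda>j. abs_pline (L j)) C \<and> tangency_point (C (i, j)) a = p"
    "touching_instance (\<lambda>i. abs_pline (K i)) (\<lambda>j. abs_pline (L j)) C' \<and> tangency_point (C' (i, j)) a = p"
  then obtain t t' where t: "\<forall>i\<in>{1, 2}. \<forall>j\<in>{1, 2}. t (i, j) \<noteq> 0" "touching_ratios K L t" "C = grid_conics K L t"
      "tangency_point (C (i, j)) a = p"
    and t': "touching_ratios K L t'" "C' = grid_conics K L t'" "tangency_point (C' (i, j)) a = p"
    unfolding touching_instance_iff[OF g] by blast
  have "t (i, j) = s" "t' (i, j) = s"
    using T t(3,4) t'(2,3) ij by (simp_all add: grid_conics_apply)
  then have tij: "t (i, j) = t' (i, j)" by simp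
  have "\<forall>i\<in>{1, 2}. \<forall>j\<in>{1, 2}. t (i, j) = t' (i, j)"
  proof (rule ratios_unique[where t = t and t' = t' and i = i and j = j, OF t(1) _ _ ij tij])
    show "\<forall>j\<in>{1, 2}. t (1, j) * t (2, j) = t' (1, j) * t' (2, j)"
      "\<forall>i\<in>{1, 2}. t (i, 1) * t (i, 2) = t' (i, 1) * t' (i, 2)"
      using t(2) t'(1) unfolding touching_ratios_iff_products[OF g] by simp_all
  qed
  then show "C = C'"
    unfolding t(3) t'(2) grid_conics_def by (intro restrict_ext) auto
qed

lemma grid_edge_parameter:
  assumes g: "generic_grid K L" and ij: "i \<in> {1, 2}" "j \<in> {1, 2}" and m: "m \<in> {i - 1, i}"
    and p: "lies_on p (abs_pline (K m))" "p \<noteq> meet (abs_pline (K m)) (abs_pline (L (j - 1)))"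
      "p \<noteq> meet (abs_pline (K m)) (abs_pline (L j))"
  obtains s where "s \<noteq> 0" "\<forall>t. tangency_point (grid_conic K L i j t) (abs_pline (K m)) = p \<longleftrightarrow> t = s"
proof -
  note q = generic_grid_cells[OF g ij]
  consider "m = i - 1" | "m = i" using m by blast
  then show thesis
  proof cases
    case 1
    obtain s where s: "s \<noteq> 0"
      "\<forall>t. tangency_point (inconic (K (i - 1)) (L (j - 1)) (K i) (L j) t) (abs_pline (K (i - 1))) = p \<longleftrightarrow> t = s"
      by (rule edge_point_parameter[OF q p[unfolded 1]])
    show thesis by (rule that[OF s(1)]) (use s(2) in \<open>simp add: grid_conic_def 1\<close>)
  next
    case 2
    obtain s where s: "s \<noteq> 0"
      "\<forall>t. tangency_point (inconic (K i) (L j) (K (i - 1)) (L (j - 1)) t) (abs_pline (K i)) = p \<longleftrightarrow> t = s"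
      by (rule edge_point_parameter[OF quad_opposite[OF q] p(1,3,2)[unfolded 2]])
    show thesis by (rule that[OF s(1)]) (use s(2) in \<open>simp add: grid_conic_def 2 inconic_opposite\<close>)
  qed
qed

lemma six_tangent_imp_touching_family:
  assumes g: "generic_grid K L" and six: "six_tangent K L"
  shows "touching_family (\<lambda>i. abs_pline (K i)) (\<lambda>j. abs_pline (L j))"
  unfolding touching_family_def
proof (intro ballI conjI allI impI; elim conjE)
  fix i j m p
  assume ij: "i \<in> {1, 2}" "j \<in> {1, 2}" and m: "m \<in> {i - 1, i :: nat}"
    and p: "lies_on p (abs_pline (K m))" "p \<noteq> meet (abs_pline (K m)) (abs_pline (L (j - 1)))"
      "p \<noteq> meet (abs_pline (K m)) (abs_pline (L j))"
  obtain s where "s \<noteq> 0" "\<forall>t. tangency_point (grid_conic K L i j t) (abs_pline (K m)) = p \<longleftrightarrow> t = s"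
    by (rule grid_edge_parameter[OF g ij m p])
  then show "\<exists>!C. touching_instance (\<lambda>i. abs_pline (K i)) (\<lambda>j. abs_pline (L j)) C \<and>
      tangency_point (C (i, j)) (abs_pline (K m)) = p"
    by (rule ex1_touching_instance[OF g six ij])
next
  fix i j m p
  assume ij: "i \<in> {1, 2}" "j \<in> {1, 2}" and m: "m \<in> {j - 1, j :: nat}"
    and p: "lies_on p (abs_pline (L m))" "p \<noteq> meet (abs_pline (K (i - 1))) (abs_pline (L m))"
      "p \<noteq> meet (abs_pline (K i)) (abs_pline (L m))"
  obtain s where "s \<noteq> 0" "\<forall>t. tangency_point (grid_conic L K j i t) (abs_pline (L m)) = p \<longleftrightarrow> t = s"
    by (rule grid_edge_parameter[OF generic_grid_swap[OF g] ij(2,1) m p(1) p(2,3)[unfolded meet_commute[of _ "abs_pline (L m)"]]])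
  then show "\<exists>!C. touching_instance (\<lambda>i. abs_pline (K i)) (\<lambda>j. abs_pline (L j)) C \<and>
      tangency_point (C (i, j)) (abs_pline (L m)) = p"
    unfolding grid_conic_swap[where K = K and L = L] by (rule ex1_touching_instance[OF g six ij])
qed

text \<open>
  The family is only useful once some point of an edge-line differs from both endpoints; the sum
  of the vectors of the two endpoints provides one.
\<close>

lemma touching_family_imp_instance:
  assumes g: "generic_grid K L"
    and fam: "touching_family (\<lambda>i. abs_pline (K i)) (\<lambda>j. abs_pline (L j))"
  shows "\<exists>C. touching_instance (\<lambda>i. abs_pline (K i)) (\<lambda>j. abs_pline (L j)) C"
proof -
  have q: "quad (K 0) (L 0) (K 1) (L 1)" using generic_grid_cells[OF g, of 1 1] by simp
  define v where "v = cross3 (K 0) (L 0) + cross3 (K 0) (L 1)"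
  have "abs_ppoint v \<notin> vertices (abs_pline (K 0)) (abs_pline (L 0)) (abs_pline (K 1)) (abs_pline (L 1))"
    using edge_point_not_vertex[OF q, of 1 1] by (simp add: v_def)
  then have "abs_ppoint v \<noteq> meet (abs_pline (K 0)) (abs_pline (L 0))"
    "abs_ppoint v \<noteq> meet (abs_pline (K 0)) (abs_pline (L 1))"
    by (auto simp: vertices_def)
  moreover have "lies_on (abs_ppoint v) (abs_pline (K 0))"
  proof -
    have "cross3 v (cross3 (K 0) (L 0)) \<noteq> 0"
      using quad_neq_0[OF q] quad_brackets[OF q] by (simp add: v_def cross_add_left cross_cross_common)
    then have "v \<noteq> 0" by auto
    then show ?thesis
      using quad_neq_0[OF q] by (simp add: lies_on_abs v_def inner_add_left dot_cross_self)
  qed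
  ultimately have free: "lies_on (abs_ppoint v) (abs_pline (K 0)) \<and>
      abs_ppoint v \<noteq> meet (abs_pline (K 0)) (abs_pline (L 0)) \<and>
      abs_ppoint v \<noteq> meet (abs_pline (K 0)) (abs_pline (L 1))"
    by blast
  have one: "(1 :: nat) \<in> {1, 2}" by simp
  note conjunct1[OF bspec[OF bspec[OF fam[unfolded touching_family_def] one] one]]
  note spec[OF bspec[OF this insertI1], of "abs_ppoint v"]
  then have "\<exists>!C. touching_instance (\<lambda>i. abs_pline (K i)) (\<lambda>j. abs_pline (L j)) C \<and>
      tangency_point (C (1, 1)) (abs_pline (K 0)) = abs_ppoint v"
    unfolding diff_self_eq_0 using free by (rule mp)
  then show ?thesis by blast
qed

section \<open>Concurrency and collinearity\<close>

lemma concurrent_diagonals_iff: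
  assumes g: "generic_grid K L"
  defines "r \<equiv> grid_diagonal_point (\<lambda>i. abs_pline (K i)) (\<lambda>j. abs_pline (L j))"
  shows "concurrent {join (r 1 1) (r 2 1), join (r 1 2) (r 2 2), abs_pline (L 1)} \<longleftrightarrow> six_tangent K L"
proof -
  have q: "quad (K 0) (L 0) (K 1) (L 1)" "quad (K 1) (L 0) (K 2) (L 1)"
    "quad (K 0) (L 1) (K 1) (L 2)" "quad (K 1) (L 1) (K 2) (L 2)"
    using generic_grid_cells[OF g, of 1 1] generic_grid_cells[OF g, of 2 1]
      generic_grid_cells[OF g, of 1 2] generic_grid_cells[OF g, of 2 2] by simp_all
  have "bracket (K 0) (L 1) (K 2) \<noteq> 0" using generic_grid_bracket(1)[OF g, of 0 1 2] by simp
  then show ?thesis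
    using concurrent_diagonal_vectors_iff[OF q] diagonal_point_abs(2)[OF q(1)] diagonal_point_abs(2)[OF q(2)]
      diagonal_point_abs(2)[OF q(3)] diagonal_point_abs(2)[OF q(4)]
    by (simp add: r_def grid_diagonal_point_def six_tangent_def)
qed

lemma grid_diagonal_point_swap: "grid_diagonal_point l k j i = grid_diagonal_point k l i j"
  by (simp add: grid_diagonal_point_def diagonal_point_swap)

text \<open>
  The conic with dual form \<open>E\<close> is inscribed in all four quadrilaterals and touches itself, so its
  parameters \<open>t\<close> solve the touching equations, and so do \<open>- t\<close>. The chord of contact of \<open>E\<close> on
  \<open>k\<^sub>i\<^sub>-\<^sub>1\<close> and \<open>k\<^sub>i\<close> carries the tangency points of the new conics on the \<open>l\<^sub>j\<close>.
\<close>

lemma enveloped_imp_collinear_instance: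
  assumes g: "generic_grid K L" and env: "enveloped K L E"
  defines "k \<equiv> \<lambda>i. abs_pline (K i)" and "l \<equiv> \<lambda>j. abs_pline (L j)"
  defines "r \<equiv> grid_diagonal_point k l" and "T \<equiv> tangency_point"
  shows "\<exists>C. touching_instance k l C \<and>
         pcollinear {T (C (1, 1)) (l 0), r 1 1, T (C (1, 1)) (l 1), r 1 2, T (C (1, 2)) (l 2)} \<and>
         pcollinear {T (C (1, 2)) (k 0), r 1 2, T (C (1, 2)) (k 1), r 2 2, T (C (2, 2)) (k 2)} \<and>
         pcollinear {T (C (2, 1)) (l 0), r 2 1, T (C (2, 1)) (l 1), r 2 2, T (C (2, 2)) (l 2)} \<and>
         pcollinear {T (C (1, 1)) (k 0), r 1 1, T (C (1, 1)) (k 1), r 2 1, T (C (2, 1)) (k 2)}"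
proof -
  have sym: "transpose E = E" and det: "det E \<noteq> 0"
    and iso: "\<And>i. i \<in> {0, 1, 2} \<Longrightarrow> K i \<bullet> (E *v K i) = 0" "\<And>i. i \<in> {0, 1, 2} \<Longrightarrow> L i \<bullet> (E *v L i) = 0"
    using env by (auto simp: enveloped_def)
  have "\<exists>b s. b \<noteq> 0 \<and> s \<noteq> 0 \<and> E = b *\<^sub>R pencil (K (i - 1)) (L (j - 1)) (K i) (L j) s 1"
    if ij: "i \<in> {1, 2}" "j \<in> {1, 2}" for i j
  proof -
    note q = generic_grid_cells[OF g ij]
    obtain \<alpha> \<beta> where ab: "E = pencil (K (i - 1)) (L (j - 1)) (K i) (L j) \<alpha> \<beta>"
      using ij by (elim isotropic_imp_pencil[OF q sym, rotated -1]) (auto intro!: iso)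
    then have "\<alpha> \<noteq> 0" "\<beta> \<noteq> 0" using det ab det_pencil_neq_0_iff[OF q] by metis+
    then show ?thesis
      using ab by (intro exI[of _ \<beta>] exI[of _ "\<alpha> / \<beta>"]) (simp flip: pencil_scaleR)
  qed
  then have "\<forall>x. \<exists>b s. x \<in> {1, 2} \<times> {1, 2} \<longrightarrow> b \<noteq> 0 \<and> s \<noteq> 0 \<and>
      E = b *\<^sub>R pencil (K (fst x - 1)) (L (snd x - 1)) (K (fst x)) (L (snd x)) s 1"
    by (metis mem_Sigma_iff prod.collapse)
  then obtain b t where bt: "x \<in> {1, 2} \<times> {1, 2} \<Longrightarrow> b x \<noteq> 0 \<and> t x \<noteq> 0 \<and>
      E = b x *\<^sub>R pencil (K (fst x - 1)) (L (snd x - 1)) (K (fst x)) (L (snd x)) (t x) 1" for x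
    by metis
  have b: "b (i, j) \<noteq> 0" and t: "t (i, j) \<noteq> 0"
    and E: "E = b (i, j) *\<^sub>R pencil (K (i - 1)) (L (j - 1)) (K i) (L j) (t (i, j)) 1"
    if "i \<in> {1, 2}" "j \<in> {1, 2}" for i j
    using bt[of "(i, j)", unfolded fst_conv snd_conv, OF SigmaI[OF that]] by blast+
  have "grid_conic K L i j (t (i, j)) = conic_of_dual E" if "i \<in> {1, 2}" "j \<in> {1, 2}" for i j
  proof -
    have "E = pencil (K (i - 1)) (L (j - 1)) (K i) (L j) (b (i, j) * t (i, j)) (b (i, j) * 1)"
      unfolding pencil_scaleR by (rule E[OF that])
    then show ?thesis
      using conic_of_dual_pencil[OF generic_grid_cells[OF g that], of "b (i, j)"] b[OF that]
      by (simp add: grid_conic_def)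
  qed
  then have "touching_ratios K L t"
    by (simp add: touching_ratios_iff[OF g])
  \<comment> \<open>each touching equation involves a product of two parameters\<close>
  then have "touching_ratios K L (\<lambda>x. - t x)"
    by (simp add: touching_ratios_def)
  then have inst: "touching_instance k l (grid_conics K L (\<lambda>x. - t x))"
    unfolding k_def l_def touching_instance_iff[OF g] using t
    by (intro exI[of _ "\<lambda>x. - t x"]) auto
  define a where "a i = abs_pline (cross3 (E *v K (i - 1)) (E *v K i))" for i
  define a' where "a' j = abs_pline (cross3 (E *v L (j - 1)) (E *v L j))" for j
  let ?C = "grid_conics K L (\<lambda>x. - t x)"
  have on: "lies_on (r i j) (a i)" "lies_on (T (?C (i, j)) (l (j - 1))) (a i)" "lies_on (T (?C (i, j)) (l j)) (a i)"
    if ij: "i \<in> {1, 2}" "j \<in> {1, 2}" for i j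
    using chord_collinear[OF generic_grid_cells[OF g ij] det E[OF ij]] ij
    by (simp_all add: r_def T_def k_def l_def a_def grid_diagonal_point_def grid_conics_apply grid_conic_def)
  have on': "lies_on (r i j) (a' j)" "lies_on (T (?C (i, j)) (k (i - 1))) (a' j)" "lies_on (T (?C (i, j)) (k i)) (a' j)"
    if ij: "i \<in> {1, 2}" "j \<in> {1, 2}" for i j
    using chord_collinear[OF quad_swap[OF generic_grid_cells[OF g ij]] det E[OF ij, folded pencil_swap[of "L (j - 1)" "K (i - 1)" "L j" "K i"]]] ij
    by (simp_all add: r_def T_def k_def l_def a'_def grid_diagonal_point_def grid_conics_apply grid_conic_def
        inconic_swap diagonal_point_swap)
  have "\<forall>p\<in>{T (?C (1, 1)) (l 0), r 1 1, T (?C (1, 1)) (l 1), r 1 2, T (?C (1, 2)) (l 2)}. lies_on p (a 1)"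
    using on[of 1 1] on[of 1 2] by simp
  moreover have "\<forall>p\<in>{T (?C (1, 2)) (k 0), r 1 2, T (?C (1, 2)) (k 1), r 2 2, T (?C (2, 2)) (k 2)}. lies_on p (a' 2)"
    using on'[of 1 2] on'[of 2 2] by simp
  moreover have "\<forall>p\<in>{T (?C (2, 1)) (l 0), r 2 1, T (?C (2, 1)) (l 1), r 2 2, T (?C (2, 2)) (l 2)}. lies_on p (a 2)"
    using on[of 2 1] on[of 2 2] by simp
  moreover have "\<forall>p\<in>{T (?C (1, 1)) (k 0), r 1 1, T (?C (1, 1)) (k 1), r 2 1, T (?C (2, 1)) (k 2)}. lies_on p (a' 1)"
    using on'[of 1 1] on'[of 2 1] by simp
  ultimately show ?thesis
    unfolding pcollinear_def by (intro exI[of _ ?C] conjI inst) (rule exI, assumption)+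
qed

theorem theorem7:
  fixes k l :: "nat \<Rightarrow> pline"
  assumes "generic [k 0, k 1, k 2, l 0, l 1, l 2]"
  shows
    "let r = grid_diagonal_point k l; T = tangency_point in
     all_equivalent
      [\<exists>C. nondegenerate C \<and> (\<forall>a \<in> {k 0, k 1, k 2, l 0, l 1, l 2}. \<exists>p. tangent_at C a p),
       \<exists>C. touching_instance k l C \<and>
         pcollinear {T (C (1, 1)) (l 0), r 1 1, T (C (1, 1)) (l 1), r 1 2, T (C (1, 2)) (l 2)} \<and>
         pcollinear {T (C (1, 2)) (k 0), r 1 2, T (C (1, 2)) (k 1), r 2 2, T (C (2, 2)) (k 2)} \<and>
         pcollinear {T (C (2, 1)) (l 0), r 2 1, T (C (2, 1)) (l 1), r 2 2, T (C (2, 2)) (l 2)} \<and>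
         pcollinear {T (C (1, 1)) (k 0), r 1 1, T (C (1, 1)) (k 1), r 2 1, T (C (2, 1)) (k 2)},
       \<exists>C. touching_instance k l C,
       touching_family k l,
       concurrent {join (r 1 1) (r 2 1), join (r 1 2) (r 2 2), l 1},
       concurrent {join (r 1 1) (r 1 2), join (r 2 1) (r 2 2), k 1}]"
proof -
  have rep: "\<exists>v. v \<noteq> 0 \<and> a = abs_pline v" for a
    using pline_rep by blast
  obtain K where K: "\<And>i. K i \<noteq> 0" "\<And>i. k i = abs_pline (K i)"
    using choice[of "\<lambda>i v. v \<noteq> 0 \<and> k i = abs_pline v"] rep by blast
  obtain L where L: "\<And>j. L j \<noteq> 0" "\<And>j. l j = abs_pline (L j)"
    using choice[of "\<lambda>j v. v \<noteq> 0 \<and> l j = abs_pline v"] rep by blast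
  have kl: "k = (\<lambda>i. abs_pline (K i))" "l = (\<lambda>j. abs_pline (L j))" using K L by auto
  have g: "generic_grid K L"
    by (rule generic_imp_generic_grid[OF assms[unfolded kl] K(1) L(1)])
  define r where "r = grid_diagonal_point k l"
  define T where "T = tangency_point"
  have i: "(\<exists>C. nondegenerate C \<and> (\<forall>a \<in> {k 0, k 1, k 2, l 0, l 1, l 2}. \<exists>p. tangent_at C a p)) \<longleftrightarrow> six_tangent K L"
    unfolding kl
    by (rule trans[OF ex_tangent_conic_iff_enveloped[OF K(1) L(1)] ex_enveloped_iff_six_tangent[OF g]])
  have iii: "(\<exists>C. touching_instance k l C) \<longleftrightarrow> six_tangent K L"
    and iv: "touching_family k l \<longleftrightarrow> six_tangent K L"
    using touching_instance_imp_six_tangent[OF g] touching_family_imp_instance[OF g]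
      six_tangent_imp_touching_family[OF g] unfolding kl by blast+
  have ii: "(\<exists>C. touching_instance k l C \<and>
         pcollinear {T (C (1, 1)) (l 0), r 1 1, T (C (1, 1)) (l 1), r 1 2, T (C (1, 2)) (l 2)} \<and>
         pcollinear {T (C (1, 2)) (k 0), r 1 2, T (C (1, 2)) (k 1), r 2 2, T (C (2, 2)) (k 2)} \<and>
         pcollinear {T (C (2, 1)) (l 0), r 2 1, T (C (2, 1)) (l 1), r 2 2, T (C (2, 2)) (l 2)} \<and>
         pcollinear {T (C (1, 1)) (k 0), r 1 1, T (C (1, 1)) (k 1), r 2 1, T (C (2, 1)) (k 2)})
      \<longleftrightarrow> six_tangent K L" (is "?ii \<longleftrightarrow> _")
  proof
    assume ?ii
    then show "six_tangent K L" using iii by blast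
  next
    assume "six_tangent K L"
    then obtain E where "enveloped K L E" using ex_enveloped_iff_six_tangent[OF g] by blast
    then show ?ii
      using enveloped_imp_collinear_instance[OF g] unfolding r_def T_def kl by blast
  qed
  have v: "concurrent {join (r 1 1) (r 2 1), join (r 1 2) (r 2 2), l 1} \<longleftrightarrow> six_tangent K L"
    using concurrent_diagonals_iff[OF g] by (simp only: r_def kl)
  have vi: "concurrent {join (r 1 1) (r 1 2), join (r 2 1) (r 2 2), k 1} \<longleftrightarrow> six_tangent K L"
    using concurrent_diagonals_iff[OF generic_grid_swap[OF g]]
    by (simp only: r_def kl six_tangent_swap grid_diagonal_point_swap[of "\<lambda>j. abs_pline (L j)"])
  show ?thesis
    unfolding Let_def all_equivalent_def r_def[symmetric] T_def[symmetric]
    using i ii iii iv v vi by simp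
qed

end
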